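(* For every $s\in\mathbb{N}_0$, the monic orthogonal polynomial $Q_{2^s}$ of degree $2^s$ with respect to the equilibrium measure $\mu_{K(\gamma)}$ coincides with the Chebyshev polynomial of degree $2^s$ for $K(\gamma)$, which is $P_{2^s}+\frac{r_s}{2}$; that is, $Q_{2^s}=P_{2^s}+\frac{r_s}{2}$.
   Context: $\mathbb{N}_0=\mathbb{N}\cup\{0\}$. Let $\gamma=(\gamma_s)_{s=1}^\infty$ with $0<\gamma_s<1/4$ for all $s$. Put $r_0=1$ and $r_s=\gamma_s r_{s-1}^2$ for $s\ge 1$. Define polynomials recursively by $P_1(x)=x-1$ and $P_{2^{s+1}}(x)=P_{2^s}(x)\,(P_{2^s}(x)+r_s)$ for $s\in\mathbb{N}_0$ (so $\deg P_{2^s}=2^s$). Let $E_s=\{x\in\mathbb{R}: P_{2^{s+1}}(x)\le 0\}$; then $E_{s+1}\subset E_s$ and $K(\gamma)=\bigcap_{s=0}^\infty E_s$ is a (compact) Cantor set. It is assumed throughout that $K(\gamma)$ has positive logarithmic capacity, $Cap(K(\gamma))=\exp\left(\sum_{k=1}^\infty 2^{-k}\log\gamma_k\right)>0$. $\mu_{K(\gamma)}$ is the equilibrium measure (in the sense of logarithmic potential theory) of $K(\gamma)$, and $Q_n$ is the monic orthogonal polynomial of degree $n$ with respect to $\mu_{K(\gamma)}$. The Chebyshev polynomial of degree $n$ for a compact set $K$ is the monic polynomial of degree $n$ with minimal supremum norm on $K$. *)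

theory Defs
  imports "HOL-Probability.Probability" "HOL-Computational_Algebra.Polynomial"
begin

text \<open>
  The kernel is $\log (1/|x-y|)$. The diagonal is treated separately because \<open>ln 0 = 0\<close> in HOL,
  whereas the kernel is $+\infty$ there.
\<close>

definition log_kernel :: "'a::metric_space \<Rightarrow> 'a \<Rightarrow> ereal" where
  "log_kernel x y = (if x = y then \<infinity> else ereal (- ln (dist x y)))"

text \<open>
  The double integral of the kernel, as the integral of its positive part minus the integral of its
  negative part. For a probability measure carried by a compact set the latter is finite, so the
  difference is a well-defined value in $(-\infty, +\infty]$. Note that \<open>e2ennreal\<close> sends negative
  values to 0.
\<close>

definition log_energy :: "'a::metric_space measure \<Rightarrow> ereal" where
  "log_energy \<mu> =
     enn2ereal (\<integral>\<^sup>+x. (\<integral>\<^sup>+y. e2ennreal (log_kernel x y) \<partial>\<mu>) \<partial>\<mu>)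
   - enn2ereal (\<integral>\<^sup>+x. (\<integral>\<^sup>+y. e2ennreal (- log_kernel x y) \<partial>\<mu>) \<partial>\<mu>)"

definition prob_measures_on :: "'a::metric_space set \<Rightarrow> 'a measure set" where
  "prob_measures_on K = {\<mu>. prob_space \<mu> \<and> sets \<mu> = sets borel \<and> emeasure \<mu> K = 1}"

text \<open>
  $\exp(-\inf_\mu I(\mu))$, for compact \<open>K\<close>. It is 0 if every probability measure on \<open>K\<close> has
  infinite energy.
\<close>

definition log_capacity :: "'a::metric_space set \<Rightarrow> real" where
  "log_capacity K =
     (let V = (INF \<mu>\<in>prob_measures_on K. log_energy \<mu>)
      in if V = \<infinity> then 0 else exp (- real_of_ereal V))"

text \<open>Meant for compact \<open>K\<close> of positive capacity, where exactly one such \<open>\<mu>\<close> exists.\<close>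

definition is_equilibrium_measure :: "'a::metric_space set \<Rightarrow> 'a measure \<Rightarrow> bool" where
  "is_equilibrium_measure K \<mu> \<longleftrightarrow>
     \<mu> \<in> prob_measures_on K \<and> (\<forall>\<nu>\<in>prob_measures_on K. log_energy \<mu> \<le> log_energy \<nu>)"

definition is_monic_orthogonal_poly :: "real measure \<Rightarrow> nat \<Rightarrow> real poly \<Rightarrow> bool" where
  "is_monic_orthogonal_poly \<mu> n Q \<longleftrightarrow>
     degree Q = n \<and> lead_coeff Q = 1 \<and>
     (\<forall>q. degree q < n \<longrightarrow> (\<integral>x. poly Q x * poly q x \<partial>\<mu>) = 0)"

definition sup_norm_on :: "real set \<Rightarrow> real poly \<Rightarrow> real" where
  "sup_norm_on K p = (SUP x\<in>K. \<bar>poly p x\<bar>)"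

definition is_chebyshev_poly :: "real set \<Rightarrow> nat \<Rightarrow> real poly \<Rightarrow> bool" where
  "is_chebyshev_poly K n T \<longleftrightarrow>
     degree T = n \<and> lead_coeff T = 1 \<and>
     (\<forall>q. degree q = n \<and> lead_coeff q = 1 \<longrightarrow> sup_norm_on K T \<le> sup_norm_on K q)"

text \<open>The sequence \<open>\<gamma>\<close> is indexed from 1; the value \<open>\<gamma> 0\<close> is never used.\<close>

fun r_seq :: "(nat \<Rightarrow> real) \<Rightarrow> nat \<Rightarrow> real" where
  "r_seq \<gamma> 0 = 1"
| "r_seq \<gamma> (Suc s) = \<gamma> (Suc s) * (r_seq \<gamma> s)^2"

text \<open>\<open>P_pow2 \<gamma> s\<close> is $P_{2^s}$: the argument is the exponent, not the degree.\<close>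

fun P_pow2 :: "(nat \<Rightarrow> real) \<Rightarrow> nat \<Rightarrow> real poly" where
  "P_pow2 \<gamma> 0 = [:-1, 1:]"
| "P_pow2 \<gamma> (Suc s) = P_pow2 \<gamma> s * (P_pow2 \<gamma> s + [:r_seq \<gamma> s:])"

definition E_set :: "(nat \<Rightarrow> real) \<Rightarrow> nat \<Rightarrow> real set" where
  "E_set \<gamma> s = {x. poly (P_pow2 \<gamma> (Suc s)) x \<le> 0}"

definition cantor_K :: "(nat \<Rightarrow> real) \<Rightarrow> real set" where
  "cantor_K \<gamma> = (\<Inter>s. E_set \<gamma> s)"

end

theory Submission
  imports Defs
begin

text \<open>
  Put $F_s = P_{2^s} + r_s/2$. The recursion becomes $F_{s+1} = F_s^2 - c_s$ with
  $c_s = r_s^2/4 - r_{s+1}/2$, and $E_s = \{|F_s| \le r_s/2\}$. Whether a point lies in $K(\gamma)$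
  depends only on $F_s^2$ there, and $F_s$ takes every value in $[-r_s/2, r_s/2]$; so
  $F_s(K(\gamma))$ is symmetric about 0. Orthogonality comes from this symmetry, and both claims
  use one algebraic step: a polynomial of degree below $2^{s+1}$ is $F_s A + B$ with $A$ and $B$ of
  degree below $2^s$.

  Chebyshev property. By induction through $p = F_s A + B$, the sum of a polynomial of degree
  below $2^s$ over the $2^s$ points of a fibre $F_s = a$, where $|a| \le r_s/2$, does not
  depend on $a$ (\<open>sum_fibre_constant\<close>). Hence the sum of a monic polynomial $q$ of degree $2^s$ over
  $\{F_s = r_s/2\}$ minus its sum over $\{F_s = -r_s/2\}$ is the same for all such $q$, namely
  $2^s r_s$. Both fibres lie in $K(\gamma)$, so $\sup_{K(\gamma)} |q| \ge r_s/2$. When equality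
  holds, $q$ agrees with $F_s$ at $2^s$ points, so $q = F_s$.

  Orthogonality. Let $\mu$ minimize the logarithmic energy $I$ on a symmetric set inside
  $[-1/2, 1/2]$, let $\mu'$ be its reflection and $\rho = (\mu + \mu')/2$. Minimality gives
  $I(\mu) \le I(\rho)$, hence $I(\mu) \le I(\mu, \mu')$ for the mutual energy. Since the kernel is
  strictly positive definite, this forces $\mu = \mu'$ (\<open>reflection_invariant\<close>). Positive
  definiteness is read off from a representation of $-\ln|x - y|$, for $|x - y| \le 1$, as a mixture of
  products $1_W(x) 1_W(y)$ over intervals $W$: it turns mutual energy into an inner product of the
  functions $W \mapsto \mu(W)$ (\<open>mutual_energy_eq_window_integral\<close>).

  The property of being a minimizer moves along the recursion. From
  $|x^2 - y^2| = |x - y| |x + y|$ one sees that the energy of the image under $x \mapsto x^2 - c$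
  is twice the energy of the symmetrized measure, so the image of a minimizer on $K$ minimizes on
  the image of $K$ (\<open>minimizes_quadratic_image\<close>). Starting with $F_0(x) = x - 1/2$, induction
  shows that the image of the equilibrium measure under every $F_s$ is symmetric. So
  $\int F_s\, h(F_s^2)\, d\mu = 0$ for all polynomials $h$, and another induction through
  $p = F_s A + B$ gives $\int F_s q\, d\mu = 0$ whenever $\deg q < 2^s$. Uniqueness holds
  because a measure of finite energy has no atoms: no nonzero polynomial vanishes almost everywhere.
\<close>

section \<open>The logarithmic kernel as a mixture of windows\<close>

text \<open>
  At distances up to 1 this is the kernel itself; at larger distances the truncation gives 0.
\<close>

definition kern :: "real \<Rightarrow> real \<Rightarrow> ennreal" where
  "kern x y = e2ennreal (log_kernel x y)"

lemma kern_eq: "kern x y = (if x = y then \<infinity> else ennreal (- ln \<bar>x - y\<bar>))"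
  by (simp add: kern_def log_kernel_def dist_real_def)

lemma measurable_kern [measurable]:
  assumes [measurable]: "f \<in> borel_measurable M" "g \<in> borel_measurable M"
  shows "(\<lambda>x. kern (f x) (g x)) \<in> borel_measurable M"
  unfolding kern_eq by measurable

text \<open>
  The length is cut off at 1, so that the single weight $r^{-2}$ on $(0, \infty)$ serves for both
  terms of $-\ln t = \int_t^1 r^{-2}(r - t)\,dr + (1 - t)$ in the representation of the kernel.
  With \<open>a\<close> as right endpoint, a window of length 1 ending in $[-1/2, 1/2)$ has the value of the
  distribution function at \<open>a\<close> as its measure, for measures on $[-1/2, 1/2]$.
\<close>

definition window :: "real \<Rightarrow> real \<Rightarrow> real set" where
  "window r a = {a - min r 1..a}"

lemma nn_integral_window_overlap:
  "(\<integral>\<^sup>+a. indicator (window r a) x * indicator (window r a) y \<partial>lborel)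
     = ennreal (min r 1 - \<bar>x - y\<bar>)"
proof -
  have "(\<integral>\<^sup>+a. indicator (window r a) x * indicator (window r a) y \<partial>lborel)
      = (\<integral>\<^sup>+a. indicator {max x y..min x y + min r 1} a \<partial>lborel)"
    by (intro nn_integral_cong) (auto simp: window_def indicator_def)
  also have "\<dots> = emeasure lborel {max x y..min x y + min r 1}"
    by simp
  also have "\<dots> = ennreal (min r 1 - \<bar>x - y\<bar>)"
    by (auto simp: emeasure_lborel_Icc_eq ennreal_neg max_def min_def abs_if intro!: arg_cong[where f=ennreal])
  finally show ?thesis .
qed

text \<open>
  On $[t, 1]$ the integrand $r^{-1} - t r^{-2}$ has the antiderivative $\ln r + t/r$ and
  contributes $t - 1 - \ln t$; on $[1, \infty)$ the integrand $(1 - t) r^{-2}$ contributes $1 - t$.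
\<close>

lemma nn_integral_overlap_lengths:
  fixes t :: real
  assumes "0 < t" "t \<le> 1"
  shows "(\<integral>\<^sup>+r. ennreal (indicator {0<..} r / r\<^sup>2) * ennreal (min r 1 - t) \<partial>lborel) = ennreal (- ln t)"
proof -
  have "(\<integral>\<^sup>+r. ennreal (indicator {0<..} r / r\<^sup>2) * ennreal (min r 1 - t) \<partial>lborel)
      = (\<integral>\<^sup>+r. ennreal (1 / r - t / r\<^sup>2) * indicator {t..1} r
           + ennreal ((1 - t) / r\<^sup>2) * indicator {1..} r \<partial>lborel)"
  proof (rule nn_integral_cong_AE)
    have "AE r in lborel. r \<noteq> (1::real)" by (rule AE_lborel_singleton)
    then show "AE r in lborel. ennreal (indicator {0<..} r / r\<^sup>2) * ennreal (min r 1 - t)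
        = ennreal (1 / r - t / r\<^sup>2) * indicator {t..1} r + ennreal ((1 - t) / r\<^sup>2) * indicator {1..} r"
    proof eventually_elim
      case (elim r)
      consider "r \<le> 0" | "0 < r" "r < t" | "t \<le> r" "r < 1" | "1 < r" using elim by linarith
      then show ?case
      proof cases
        case 3
        then have "ennreal (1 / r\<^sup>2) * ennreal (r - t) = ennreal (1 / r - t / r\<^sup>2)"
          using assms by (subst ennreal_mult[symmetric]) (auto simp: field_simps power2_eq_square)
        then show ?thesis using 3 assms by (simp add: min_def)
      next
        case 4
        then show ?thesis using assms by (simp add: ennreal_mult[symmetric] min_def)
      qed (use assms in \<open>auto simp: ennreal_neg\<close>)
    qed
  qed
  also have "\<dots> = (\<integral>\<^sup>+r. ennreal (1 / r - t / r\<^sup>2) * indicator {t..1} r \<partial>lborel)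
                + (\<integral>\<^sup>+r. ennreal ((1 - t) / r\<^sup>2) * indicator {1..} r \<partial>lborel)"
    by (intro nn_integral_add) measurable
  also have "(\<integral>\<^sup>+r. ennreal (1 / r - t / r\<^sup>2) * indicator {t..1} r \<partial>lborel)
      = ennreal ((ln 1 + t / 1) - (ln t + t / t))"
  proof (rule nn_integral_FTC_Icc)
    fix r assume r: "r \<in> {t..1}"
    then show "((\<lambda>r. ln r + t / r) has_real_derivative 1 / r - t / r\<^sup>2) (at r)"
      using assms by (auto intro!: derivative_eq_intros simp: power2_eq_square)
    show "0 \<le> 1 / r - t / r\<^sup>2"
      using assms r by (auto simp: field_simps power2_eq_square)
  qed (use assms in auto)
  also have "(\<integral>\<^sup>+r. ennreal ((1 - t) / r\<^sup>2) * indicator {1..} r \<partial>lborel) = ennreal (0 - (- (1 - t) / 1))"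
  proof (rule nn_integral_FTC_atLeast[where F = "\<lambda>r. - (1 - t) / r"])
    show "((\<lambda>r. - (1 - t) / r) \<longlongrightarrow> 0) at_top"
      by (intro tendsto_divide_0[OF tendsto_const] filterlim_at_top_imp_at_infinity filterlim_ident)
  qed (use assms in \<open>auto intro!: derivative_eq_intros simp: power2_eq_square\<close>)
  also have "ennreal ((ln 1 + t / 1) - (ln t + t / t)) + ennreal (0 - (- (1 - t) / 1)) = ennreal (- ln t)"
  proof -
    have "ln t \<le> t - 1" using assms ln_le_minus_one by blast
    then show ?thesis using assms by (subst ennreal_plus[symmetric]) auto
  qed
  finally show ?thesis .
qed

lemma kern_eq_overlap_integral:
  assumes "\<bar>x - y\<bar> \<le> 1"
  shows "kern x y = (\<integral>\<^sup>+r. ennreal (indicator {0<..} r / r\<^sup>2) * ennreal (min r 1 - \<bar>x - y\<bar>) \<partial>lborel)"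
proof (cases "x = y")
  case False
  then show ?thesis using assms nn_integral_overlap_lengths[of "\<bar>x - y\<bar>"] by (simp add: kern_eq)
next
  case True
  let ?I = "\<integral>\<^sup>+r. ennreal (indicator {0<..} r / r\<^sup>2) * ennreal (min r 1 - \<bar>x - y\<bar>) \<partial>lborel"
  \<comment> \<open>The overlap grows as the distance shrinks, so the value at distance $e^{-n}$ is a lower bound.\<close>
  have "ennreal (real n) \<le> ?I" for n
  proof -
    have "ennreal (real n) = (\<integral>\<^sup>+r. ennreal (indicator {0<..} r / r\<^sup>2) * ennreal (min r 1 - exp (- real n)) \<partial>lborel)"
      by (subst nn_integral_overlap_lengths) auto
    also have "\<dots> \<le> ?I"
      using True by (intro nn_integral_mono mult_left_mono ennreal_leI) (simp_all add: add_increasing2 diff_le_eq)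
    finally show ?thesis .
  qed
  then have le: "of_nat n \<le> ?I" for n
    unfolding ennreal_of_nat_eq_real_of_nat .
  have "?I = \<infinity>"
  proof (rule ccontr)
    assume "?I \<noteq> \<infinity>"
    then obtain n where "?I < of_nat n"
      using ennreal_Ex_less_of_nat[of ?I] by (auto simp: less_top)
    then show False using le[of n] by (meson leD)
  qed
  with True show ?thesis by (simp add: kern_eq)
qed

definition mutual_energy :: "real measure \<Rightarrow> real measure \<Rightarrow> ennreal" where
  "mutual_energy M N = (\<integral>\<^sup>+x. \<integral>\<^sup>+y. kern x y \<partial>N \<partial>M)"

lemma indicator_window:
  "indicator (window r a) x = (if a - min r 1 \<le> x \<and> x \<le> a then 1 else 0)"
  by (simp add: window_def)

lemma window_borel [measurable]: "window r a \<in> sets borel"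
  by (simp add: window_def)

lemma measurable_measure_window:
  assumes "real_distribution M"
  shows "(\<lambda>\<omega>. measure M (window (fst \<omega>) (snd \<omega>))) \<in> borel_measurable (lborel \<Otimes>\<^sub>M lborel)"
proof -
  interpret real_distribution M by fact
  have "(\<lambda>\<omega>. \<integral>\<^sup>+x. indicator (window (fst \<omega>) (snd \<omega>)) x \<partial>M) \<in> borel_measurable (lborel \<Otimes>\<^sub>M lborel)"
    unfolding indicator_window by measurable
  then have "(\<lambda>\<omega>. enn2real (emeasure M (window (fst \<omega>) (snd \<omega>)))) \<in> borel_measurable (lborel \<Otimes>\<^sub>M lborel)"
    by simp
  then show ?thesis by (simp add: measure_def)
qed

text \<open>
  Two points both lie in the window $[a - \min(r,1), a]$ for a set of \<open>a\<close> of length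
  $\max(0, \min(r, 1) - |x - y|)$. Integrating this against $r^{-2}$ gives the kernel, and Tonelli's
  theorem moves the two measures inside. The result is a diagonal quadratic form with nonnegative
  weights, whereas positivity of the energy form is invisible in its definition.
\<close>

lemma mutual_energy_eq_window_integral:
  assumes M: "real_distribution M" "AE x in M. \<bar>x\<bar> \<le> 1/2"
    and N: "real_distribution N" "AE x in N. \<bar>x\<bar> \<le> 1/2"
  shows "mutual_energy M N = (\<integral>\<^sup>+\<omega>. ennreal (indicator {0<..} (fst \<omega>) / (fst \<omega>)\<^sup>2) *
           ennreal (measure M (window (fst \<omega>) (snd \<omega>)) * measure N (window (fst \<omega>) (snd \<omega>)))
           \<partial>(lborel \<Otimes>\<^sub>M lborel))"
proof -
  interpret M: real_distribution M by fact
  interpret N: real_distribution N by fact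
  let ?L = "lborel \<Otimes>\<^sub>M lborel :: (real \<times> real) measure"
  interpret L: sigma_finite_measure ?L
    by (intro sigma_finite_pair_measure lborel.sigma_finite_measure_axioms)
  interpret NxL: pair_sigma_finite N ?L ..
  interpret MxL: pair_sigma_finite M ?L ..
  define w where "w \<omega> = ennreal (indicator {0<..} (fst \<omega>) / (fst \<omega>)\<^sup>2)" for \<omega> :: "real \<times> real"
  define \<phi> :: "real \<times> real \<Rightarrow> real \<Rightarrow> ennreal"
    where "\<phi> \<omega> x = indicator (window (fst \<omega>) (snd \<omega>)) x" for \<omega> x
  have [measurable]: "w \<in> borel_measurable ?L"
    unfolding w_def by measurable
  have [measurable]: "(\<lambda>p. \<phi> (f p) (g p)) \<in> borel_measurable P"
    if [measurable]: "f \<in> P \<rightarrow>\<^sub>M ?L" "g \<in> borel_measurable P" for f g and P :: "'z measure"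
  proof -
    have [measurable]: "(\<lambda>p. fst (f p)) \<in> borel_measurable P" "(\<lambda>p. snd (f p)) \<in> borel_measurable P"
      using measurable_compose[OF that(1) measurable_fst] measurable_compose[OF that(1) measurable_snd]
      by simp_all
    show ?thesis unfolding \<phi>_def indicator_window by measurable
  qed
  have kern: "kern x y = (\<integral>\<^sup>+\<omega>. w \<omega> * (\<phi> \<omega> x * \<phi> \<omega> y) \<partial>?L)" if "\<bar>x\<bar> \<le> 1/2" "\<bar>y\<bar> \<le> 1/2" for x y
  proof -
    have "(\<integral>\<^sup>+\<omega>. w \<omega> * (\<phi> \<omega> x * \<phi> \<omega> y) \<partial>?L)
        = (\<integral>\<^sup>+r. \<integral>\<^sup>+a. w (r, a) * (\<phi> (r, a) x * \<phi> (r, a) y) \<partial>lborel \<partial>lborel)"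
      by (intro lborel.nn_integral_fst[symmetric]) measurable
    also have "\<dots> = (\<integral>\<^sup>+r. ennreal (indicator {0<..} r / r\<^sup>2) * ennreal (min r 1 - \<bar>x - y\<bar>) \<partial>lborel)"
      unfolding w_def \<phi>_def fst_conv snd_conv
      by (subst nn_integral_cmult) (auto simp: indicator_window nn_integral_window_overlap[unfolded indicator_window])
    finally show ?thesis using that by (subst kern_eq_overlap_integral) auto
  qed
  have "mutual_energy M N = (\<integral>\<^sup>+x. \<integral>\<^sup>+y. \<integral>\<^sup>+\<omega>. w \<omega> * (\<phi> \<omega> x * \<phi> \<omega> y) \<partial>?L \<partial>N \<partial>M)"
    unfolding mutual_energy_def
  proof (rule nn_integral_cong_AE)
    show "AE x in M. (\<integral>\<^sup>+y. kern x y \<partial>N) = (\<integral>\<^sup>+y. \<integral>\<^sup>+\<omega>. w \<omega> * (\<phi> \<omega> x * \<phi> \<omega> y) \<partial>?L \<partial>N)"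
      using M(2)
    proof eventually_elim
      case (elim x)
      show ?case
        by (rule nn_integral_cong_AE) (use N(2) in \<open>eventually_elim, use elim kern in blast\<close>)
    qed
  qed
  also have "\<dots> = (\<integral>\<^sup>+x. \<integral>\<^sup>+\<omega>. \<integral>\<^sup>+y. w \<omega> * (\<phi> \<omega> x * \<phi> \<omega> y) \<partial>N \<partial>?L \<partial>M)"
    by (intro nn_integral_cong NxL.Fubini'[symmetric]) measurable
  also have "\<dots> = (\<integral>\<^sup>+x. \<integral>\<^sup>+\<omega>. (w \<omega> * \<phi> \<omega> x) * (\<integral>\<^sup>+y. \<phi> \<omega> y \<partial>N) \<partial>?L \<partial>M)"
    by (intro nn_integral_cong) (simp add: mult.assoc[symmetric] nn_integral_cmult)
  also have "\<dots> = (\<integral>\<^sup>+\<omega>. \<integral>\<^sup>+x. (w \<omega> * \<phi> \<omega> x) * (\<integral>\<^sup>+y. \<phi> \<omega> y \<partial>N) \<partial>M \<partial>?L)"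
    by (intro MxL.Fubini'[symmetric]) measurable
  also have "\<dots> = (\<integral>\<^sup>+\<omega>. w \<omega> * ((\<integral>\<^sup>+x. \<phi> \<omega> x \<partial>M) * (\<integral>\<^sup>+y. \<phi> \<omega> y \<partial>N)) \<partial>?L)"
    by (intro nn_integral_cong) (simp add: nn_integral_cmult nn_integral_multc mult.assoc)
  also have "\<dots> = (\<integral>\<^sup>+\<omega>. w \<omega> * ennreal (measure M (window (fst \<omega>) (snd \<omega>)) * measure N (window (fst \<omega>) (snd \<omega>))) \<partial>?L)"
    by (simp add: \<phi>_def[abs_def] nn_integral_indicator M.emeasure_eq_measure N.emeasure_eq_measure ennreal_mult)
  finally show ?thesis unfolding w_def .
qed

text \<open>
  This is $m^2 + n^2 = 2mn + (m - n)^2$, integrated over all windows: the energy of the signed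
  measure \<open>M - N\<close> is the last integral. Written additively, it holds for infinite energies too.
\<close>

lemma mutual_energy_parallelogram:
  assumes M: "real_distribution M" "AE x in M. \<bar>x\<bar> \<le> 1/2"
    and N: "real_distribution N" "AE x in N. \<bar>x\<bar> \<le> 1/2"
  shows "mutual_energy M M + mutual_energy N N = 2 * mutual_energy M N +
     (\<integral>\<^sup>+\<omega>. ennreal (indicator {0<..} (fst \<omega>) / (fst \<omega>)\<^sup>2) *
       ennreal ((measure M (window (fst \<omega>) (snd \<omega>)) - measure N (window (fst \<omega>) (snd \<omega>)))\<^sup>2)
       \<partial>(lborel \<Otimes>\<^sub>M lborel))"
proof -
  let ?L = "lborel \<Otimes>\<^sub>M lborel :: (real \<times> real) measure"
  note [measurable] = measurable_measure_window[OF M(1)] measurable_measure_window[OF N(1)]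
  define w where "w \<omega> = ennreal (indicator {0<..} (fst \<omega>) / (fst \<omega>)\<^sup>2)" for \<omega> :: "real \<times> real"
  define m where "m \<omega> = measure M (window (fst \<omega>) (snd \<omega>))" for \<omega> :: "real \<times> real"
  define n where "n \<omega> = measure N (window (fst \<omega>) (snd \<omega>))" for \<omega> :: "real \<times> real"
  have [measurable]: "w \<in> borel_measurable ?L" "m \<in> borel_measurable ?L" "n \<in> borel_measurable ?L"
    unfolding w_def m_def n_def by measurable
  have "(\<integral>\<^sup>+\<omega>. w \<omega> * ennreal (m \<omega> * m \<omega>) \<partial>?L) + (\<integral>\<^sup>+\<omega>. w \<omega> * ennreal (n \<omega> * n \<omega>) \<partial>?L)
      = (\<integral>\<^sup>+\<omega>. w \<omega> * ennreal (m \<omega> * m \<omega>) + w \<omega> * ennreal (n \<omega> * n \<omega>) \<partial>?L)"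
    by (intro nn_integral_add[symmetric]) measurable
  also have "\<dots> = (\<integral>\<^sup>+\<omega>. 2 * (w \<omega> * ennreal (m \<omega> * n \<omega>)) + w \<omega> * ennreal ((m \<omega> - n \<omega>)\<^sup>2) \<partial>?L)"
  proof (intro nn_integral_cong)
    fix \<omega>
    have nonneg: "0 \<le> m \<omega>" "0 \<le> n \<omega>" by (simp_all add: m_def n_def)
    have "ennreal (m \<omega> * m \<omega>) + ennreal (n \<omega> * n \<omega>) = ennreal (2 * (m \<omega> * n \<omega>) + (m \<omega> - n \<omega>)\<^sup>2)"
      using nonneg by (subst ennreal_plus[symmetric]) (auto simp: power2_eq_square algebra_simps)
    also have "\<dots> = 2 * ennreal (m \<omega> * n \<omega>) + ennreal ((m \<omega> - n \<omega>)\<^sup>2)"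
      using nonneg by (subst ennreal_plus) (auto simp: ennreal_mult)
    finally show "w \<omega> * ennreal (m \<omega> * m \<omega>) + w \<omega> * ennreal (n \<omega> * n \<omega>)
        = 2 * (w \<omega> * ennreal (m \<omega> * n \<omega>)) + w \<omega> * ennreal ((m \<omega> - n \<omega>)\<^sup>2)"
      by (simp add: distrib_left[symmetric] mult.left_commute[of 2])
  qed
  also have "\<dots> = 2 * (\<integral>\<^sup>+\<omega>. w \<omega> * ennreal (m \<omega> * n \<omega>) \<partial>?L) + (\<integral>\<^sup>+\<omega>. w \<omega> * ennreal ((m \<omega> - n \<omega>)\<^sup>2) \<partial>?L)"
    by (subst nn_integral_add) (simp_all add: nn_integral_cmult)
  finally show ?thesis
    unfolding mutual_energy_eq_window_integral[OF M M] mutual_energy_eq_window_integral[OF N N]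
      mutual_energy_eq_window_integral[OF M N] w_def m_def n_def .
qed

text \<open>
  Every point is a limit from the right of points where the distribution functions agree, and
  distribution functions are continuous from the right.
\<close>

lemma real_distribution_eqI_AE_cdf:
  assumes M: "real_distribution M" and N: "real_distribution N"
    and eq: "AE x in lborel. cdf M x = cdf N x"
  shows "M = N"
proof (rule cdf_unique[OF M N], rule ext)
  fix a :: real
  interpret M: real_distribution M by fact
  interpret N: real_distribution N by fact
  have "\<exists>x. a < x \<and> x < a + 1 / Suc n \<and> cdf M x = cdf N x" for n
  proof (rule ccontr)
    assume "\<not> ?thesis"
    with eq have "AE x in lborel. x \<notin> {a<..<a + 1 / Suc n}"
      by (auto elim!: eventually_mono)
    then have "{a<..<a + 1 / Suc n} \<in> null_sets lborel"
      by (subst AE_iff_null_sets) auto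
    then show False by (simp add: null_sets_def)
  qed
  then obtain x where x: "\<And>n. a < x n" "\<And>n. x n < a + 1 / Suc n" "\<And>n. cdf M (x n) = cdf N (x n)"
    by metis
  have "(\<lambda>n. a + 1 / Suc n) \<longlonglongrightarrow> a + 0"
    by (intro tendsto_add tendsto_const LIMSEQ_Suc[OF lim_1_over_n])
  then have "x \<longlonglongrightarrow> a"
    using x(1,2) by (intro tendsto_sandwich[of "\<lambda>_. a" x sequentially "\<lambda>n. a + 1 / Suc n"])
      (auto intro!: always_eventually less_imp_le)
  then have "filterlim x (at_right a) sequentially"
    using x(1) by (auto simp: filterlim_at intro!: always_eventually less_imp_neq[symmetric])
  then have "(\<lambda>n. cdf M (x n)) \<longlonglongrightarrow> cdf M a" "(\<lambda>n. cdf N (x n)) \<longlonglongrightarrow> cdf N a"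
    using M.cdf_is_right_cont N.cdf_is_right_cont
    by (auto simp: continuous_within intro: filterlim_compose)
  with x(3) show "cdf M a = cdf N a" by (simp add: LIMSEQ_unique)
qed

text \<open>
  Strict positive definiteness: the hypothesis forces the last integral in the parallelogram identity
  to vanish, so \<open>M\<close> and \<open>N\<close> agree on almost all windows. One length $r \ge 1$ then suffices, since such windows determine the
  distribution functions of measures on $[-1/2, 1/2]$.
\<close>

lemma eq_if_mutual_energy_ge:
  assumes M: "real_distribution M" "AE x in M. \<bar>x\<bar> \<le> 1/2"
    and N: "real_distribution N" "AE x in N. \<bar>x\<bar> \<le> 1/2"
    and fin: "mutual_energy M M + mutual_energy N N < \<infinity>"
    and le: "mutual_energy M M + mutual_energy N N \<le> 2 * mutual_energy M N"
  shows "M = N"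
proof (rule real_distribution_eqI_AE_cdf[OF M(1) N(1)])
  interpret M: real_distribution M by fact
  interpret N: real_distribution N by fact
  let ?L = "lborel \<Otimes>\<^sub>M lborel :: (real \<times> real) measure"
  let ?d = "\<lambda>\<omega>. measure M (window (fst \<omega>) (snd \<omega>)) - measure N (window (fst \<omega>) (snd \<omega>))"
  let ?f = "\<lambda>\<omega>. ennreal (indicator {0<..} (fst \<omega>) / (fst \<omega>)\<^sup>2) * ennreal ((?d \<omega>)\<^sup>2)"
  note [measurable] = measurable_measure_window[OF M(1)] measurable_measure_window[OF N(1)]
  have "(\<integral>\<^sup>+\<omega>. ?f \<omega> \<partial>?L) = 0"
  proof -
    have "2 * mutual_energy M N < \<infinity>"
      using fin unfolding mutual_energy_parallelogram[OF M N] by simp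
    moreover have "2 * mutual_energy M N + (\<integral>\<^sup>+\<omega>. ?f \<omega> \<partial>?L) \<le> 2 * mutual_energy M N + 0"
      using le unfolding mutual_energy_parallelogram[OF M N] by simp
    ultimately show ?thesis
      unfolding ennreal_add_left_cancel_le by (auto simp: less_top)
  qed
  then have "AE \<omega> in ?L. ?f \<omega> = 0"
    by (subst (asm) nn_integral_0_iff_AE) measurable
  then have "AE r in lborel. AE a in lborel. ?f (r, a) = 0"
    by (rule lborel_pair.AE_pair)
  then have ae: "AE r in lborel. 1 \<le> r \<longrightarrow> (AE a in lborel. measure M (window r a) = measure N (window r a))"
    by eventually_elim (auto elim!: eventually_mono)
  have "\<exists>r\<ge>1. AE a in lborel. measure M (window r a) = measure N (window r a)"
  proof (rule ccontr)
    assume "\<not> ?thesis"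
    with ae have "AE r in lborel. r \<notin> {1..2::real}"
      by (auto elim!: eventually_mono)
    then have "{1..2::real} \<in> null_sets lborel"
      by (subst AE_iff_null_sets) auto
    then show False by (simp add: null_sets_def)
  qed
  then obtain r where r: "1 \<le> r" "AE a in lborel. measure M (window r a) = measure N (window r a)"
    by blast
  have cdf: "cdf P a = (if a \<ge> 1/2 then 1 else if a < -1/2 then 0 else measure P (window r a))"
    if P: "real_distribution P" "AE x in P. \<bar>x\<bar> \<le> 1/2" for P a
  proof -
    interpret P: real_distribution P by fact
    consider "a \<ge> 1/2" | "a < -1/2" | "-1/2 \<le> a" "a < 1/2" by linarith
    then show ?thesis
    proof cases
      case 1
      then have "AE x in P. x \<in> {..a}" using P(2) by (auto elim!: eventually_mono)
      then show ?thesis using 1 by (simp add: cdf_def P.prob_eq_1)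
    next
      case 2
      then have "AE x in P. x \<notin> {..a}" using P(2) by (auto elim!: eventually_mono)
      then show ?thesis using 2 by (simp add: cdf_def P.prob_eq_0)
    next
      case 3
      have "measure P {..a} = measure P (window r a)"
        using P(2) 3 r(1) by (intro P.finite_measure_eq_AE) (auto simp: window_def elim!: eventually_mono)
      then show ?thesis using 3 by (simp add: cdf_def)
    qed
  qed
  show "AE x in lborel. cdf M x = cdf N x"
    using r(2) by eventually_elim (simp add: cdf[OF M] cdf[OF N])
qed

section \<open>Minimizers of the energy on symmetric sets\<close>

lemma prob_measures_onD:
  assumes "M \<in> prob_measures_on K"
  shows "real_distribution M" "K \<in> sets borel" "AE x in M. x \<in> K"
proof -
  have M: "prob_space M" "sets M = sets borel" "emeasure M K = 1"
    using assms by (auto simp: prob_measures_on_def)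
  then interpret prob_space M by simp
  show "real_distribution M" using M by (simp add: real_distribution_def real_distribution_axioms_def prob_space_axioms)
  show K: "K \<in> sets borel" using M(2,3) emeasure_notin_sets[of K M] by auto
  then show "AE x in M. x \<in> K"
    using M by (intro AE_prob_1) (simp add: measure_def)
qed

lemma prob_measures_onI:
  assumes "real_distribution M" "K \<in> sets borel" "AE x in M. x \<in> K"
  shows "M \<in> prob_measures_on K"
proof -
  interpret real_distribution M by fact
  have "emeasure M K = 1"
    using assms by (intro emeasure_eq_1_AE) auto
  then show ?thesis by (simp add: prob_measures_on_def prob_space_axioms)
qed

text \<open>
  Energies are compared here in $[0, \infty]$, through the nonnegative part of the kernel. On sets
  inside an interval of length 1 this is the same as comparing logarithmic energies.
\<close>

definition minimizes_energy :: "real set \<Rightarrow> real measure \<Rightarrow> bool" where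
  "minimizes_energy K M \<longleftrightarrow> M \<in> prob_measures_on K \<and> mutual_energy M M < \<infinity> \<and>
     (\<forall>N\<in>prob_measures_on K. mutual_energy M M \<le> mutual_energy N N)"

lemma nn_integral_distr_borel:
  assumes "sets M = sets borel" "f \<in> borel \<rightarrow>\<^sub>M borel" "g \<in> borel_measurable borel"
  shows "(\<integral>\<^sup>+x. g x \<partial>distr M borel f) = (\<integral>\<^sup>+x. g (f x) \<partial>M)"
proof (rule nn_integral_distr)
  show "f \<in> M \<rightarrow>\<^sub>M borel" using assms(2) unfolding measurable_cong_sets[OF assms(1) refl] .
qed (use assms in simp)

lemma mutual_energy_distr:
  assumes M: "real_distribution M" and N: "real_distribution N"
    and [measurable]: "f \<in> borel \<rightarrow>\<^sub>M borel" "g \<in> borel \<rightarrow>\<^sub>M borel"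
  shows "mutual_energy (distr M borel f) (distr N borel g) = (\<integral>\<^sup>+x. \<integral>\<^sup>+y. kern (f x) (g y) \<partial>N \<partial>M)"
proof -
  interpret M: real_distribution M by fact
  interpret N: real_distribution N by fact
  have "mutual_energy (distr M borel f) (distr N borel g)
      = (\<integral>\<^sup>+x. \<integral>\<^sup>+y. kern x (g y) \<partial>N \<partial>distr M borel f)"
    unfolding mutual_energy_def by (intro nn_integral_cong nn_integral_distr_borel) measurable
  also have "\<dots> = (\<integral>\<^sup>+x. \<integral>\<^sup>+y. kern (f x) (g y) \<partial>N \<partial>M)"
    by (intro nn_integral_distr_borel) measurable
  finally show ?thesis .
qed

lemma real_distribution_distr:
  assumes "real_distribution M" "f \<in> borel \<rightarrow>\<^sub>M borel"
  shows "real_distribution (distr M borel f)"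
proof -
  interpret real_distribution M by fact
  have "f \<in> M \<rightarrow>\<^sub>M borel" using assms(2) by simp
  then show ?thesis by (simp add: real_distribution_def real_distribution_axioms_def prob_space_distr)
qed

lemma AE_distr_borel:
  assumes "real_distribution M" "f \<in> borel \<rightarrow>\<^sub>M borel" "K \<in> sets borel"
  shows "(AE x in distr M borel f. x \<in> K) \<longleftrightarrow> (AE x in M. f x \<in> K)"
proof -
  interpret real_distribution M by fact
  have "f \<in> M \<rightarrow>\<^sub>M borel" using assms(2) by simp
  then show ?thesis using assms(3) by (intro AE_distr_iff) auto
qed

text \<open>
  The law of $\varepsilon x$ with \<open>x\<close> drawn from \<open>M\<close> and an independent fair sign
  $\varepsilon$, that is, the average of \<open>M\<close> and its reflection.
\<close>

definition symmetrize :: "real measure \<Rightarrow> real measure" where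
  "symmetrize M = distr (M \<Otimes>\<^sub>M measure_pmf (pmf_of_set {1, -1})) borel (\<lambda>(x, e). e * x)"

lemma measurable_sign_product:
  assumes "real_distribution M"
  shows "(\<lambda>p. snd p * fst p) \<in> borel_measurable (M \<Otimes>\<^sub>M measure_pmf (P :: real pmf))"
proof -
  interpret real_distribution M by fact
  have [measurable]: "(\<lambda>p. snd p) \<in> borel_measurable (M \<Otimes>\<^sub>M measure_pmf P)"
    by (rule measurable_compose[OF measurable_snd]) simp
  show ?thesis by measurable
qed

lemma nn_integral_symmetrize:
  assumes M: "real_distribution M" and [measurable]: "f \<in> borel_measurable borel"
  shows "2 * (\<integral>\<^sup>+x. f x \<partial>symmetrize M) = (\<integral>\<^sup>+x. f x + f (- x) \<partial>M)"
proof -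
  interpret M: real_distribution M by fact
  let ?P = "measure_pmf (pmf_of_set {1, - 1 :: real})"
  interpret P: prob_space ?P by (rule prob_space_measure_pmf)
  have [measurable]: "(\<lambda>p. snd p * fst p) \<in> borel_measurable (M \<Otimes>\<^sub>M ?P)"
    by (rule measurable_sign_product[OF M])
  have "(\<integral>\<^sup>+x. f x \<partial>symmetrize M) = (\<integral>\<^sup>+p. f (snd p * fst p) \<partial>(M \<Otimes>\<^sub>M ?P))"
    unfolding symmetrize_def by (subst nn_integral_distr) (auto simp: case_prod_beta')
  also have "\<dots> = (\<integral>\<^sup>+x. \<integral>\<^sup>+e. f (e * x) \<partial>?P \<partial>M)"
    by (subst measure_pmf.nn_integral_fst[symmetric]) auto
  also have "\<dots> = (\<integral>\<^sup>+x. (f x + f (- x)) / 2 \<partial>M)"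
    by (subst nn_integral_pmf_of_set) auto
  finally show ?thesis
    by (simp add: nn_integral_divide ennreal_times_divide mult.commute[of 2] ennreal_mult_divide_eq)
qed

lemma real_distribution_symmetrize:
  assumes "real_distribution M"
  shows "real_distribution (symmetrize M)"
proof -
  interpret M: real_distribution M by fact
  interpret P: prob_space "measure_pmf (pmf_of_set {1, - 1 :: real})" by (rule prob_space_measure_pmf)
  interpret MxP: pair_prob_space M "measure_pmf (pmf_of_set {1, - 1 :: real})" ..
  have "prob_space (symmetrize M)"
    unfolding symmetrize_def case_prod_beta'
    by (intro MxP.prob_space_distr measurable_sign_product assms)
  then show ?thesis
    by (simp add: real_distribution_def real_distribution_axioms_def symmetrize_def)
qed

lemma AE_symmetrize:
  assumes M: "real_distribution M" and [measurable]: "K \<in> sets borel"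
    and AE: "AE x in M. x \<in> K" "AE x in M. - x \<in> K"
  shows "AE x in symmetrize M. x \<in> K"
proof -
  interpret M: real_distribution M by fact
  interpret S: real_distribution "symmetrize M" using real_distribution_symmetrize[OF M] .
  have "2 * (\<integral>\<^sup>+x. indicator (- K) x \<partial>symmetrize M) = (\<integral>\<^sup>+x. indicator (- K) x + indicator (- K) (- x) \<partial>M)"
    by (rule nn_integral_symmetrize[OF M]) measurable
  also have "\<dots> = (\<integral>\<^sup>+x. 0 \<partial>M)"
    by (rule nn_integral_cong_AE) (use AE in \<open>eventually_elim, auto\<close>)
  finally have "emeasure (symmetrize M) (- K) = 0" by simp
  then show ?thesis
    by (intro AE_I[where N = "- K"]) auto
qed

lemma kern_neg [simp]: "kern (- x) (- y) = kern x y" "kern (- x) y = kern x (- y)"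
proof -
  have "\<bar>- x - - y\<bar> = \<bar>x - y\<bar>" "\<bar>- x - y\<bar> = \<bar>x - - y\<bar>" by linarith+
  then show "kern (- x) (- y) = kern x y" "kern (- x) y = kern x (- y)"
    by (auto simp: kern_eq)
qed

text \<open>
  The factors of $|x^2 - y^2| = |x - y| |x + y|$ are both at most 1, so both logarithms have the
  same sign and the positive parts add up.
\<close>

lemma kern_quadratic:
  assumes "\<bar>x\<bar> \<le> 1/2" "\<bar>y\<bar> \<le> 1/2"
  shows "kern (x\<^sup>2 - c) (y\<^sup>2 - c) = kern x y + kern x (- y)"
proof (cases "x = y \<or> x = - y")
  case True
  then show ?thesis by (auto simp: kern_eq)
next
  case False
  have "\<bar>x\<^sup>2 - y\<^sup>2\<bar> = \<bar>x - y\<bar> * \<bar>x + y\<bar>"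
    by (simp add: abs_mult[symmetric] power2_eq_square algebra_simps)
  then have "ln \<bar>x\<^sup>2 - y\<^sup>2\<bar> = ln \<bar>x - y\<bar> + ln \<bar>x + y\<bar>"
    using False by (simp add: ln_mult)
  moreover have "ln \<bar>x - y\<bar> \<le> 0" "ln \<bar>x + y\<bar> \<le> 0"
    using assms False by auto
  moreover have "x\<^sup>2 \<noteq> y\<^sup>2" using False by (simp add: power2_eq_iff)
  ultimately show ?thesis
    using False by (auto simp: kern_eq ennreal_plus[symmetric] add.commute simp del: ennreal_plus)
qed

text \<open>
  The image under $x \mapsto x^2 - c$ has kernel $k(x, y) + k(x, -y)$. The four sign choices in the
  energy of the symmetrized measure, each of weight $1/4$, give this kernel with weight $1/2$.
\<close>

lemma mutual_energy_quadratic: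
  assumes M: "real_distribution M" "AE x in M. \<bar>x\<bar> \<le> 1/2"
  shows "mutual_energy (distr M borel (\<lambda>x. x\<^sup>2 - c)) (distr M borel (\<lambda>x. x\<^sup>2 - c))
       = mutual_energy M M + mutual_energy M (distr M borel uminus)"
    and "mutual_energy (distr M borel (\<lambda>x. x\<^sup>2 - c)) (distr M borel (\<lambda>x. x\<^sup>2 - c))
       = 2 * mutual_energy (symmetrize M) (symmetrize M)"
proof -
  interpret M: real_distribution M by fact
  let ?k = "\<lambda>x y. kern x y + kern x (- y)"
  have "mutual_energy (distr M borel (\<lambda>x. x\<^sup>2 - c)) (distr M borel (\<lambda>x. x\<^sup>2 - c))
      = (\<integral>\<^sup>+x. \<integral>\<^sup>+y. kern (x\<^sup>2 - c) (y\<^sup>2 - c) \<partial>M \<partial>M)"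
    by (intro mutual_energy_distr M) measurable
  also have "\<dots> = (\<integral>\<^sup>+x. \<integral>\<^sup>+y. ?k x y \<partial>M \<partial>M)"
  proof (rule nn_integral_cong_AE)
    show "AE x in M. (\<integral>\<^sup>+y. kern (x\<^sup>2 - c) (y\<^sup>2 - c) \<partial>M) = (\<integral>\<^sup>+y. ?k x y \<partial>M)"
      using M(2)
    proof eventually_elim
      case (elim x)
      show ?case
        by (rule nn_integral_cong_AE) (use M(2) in \<open>eventually_elim, use elim kern_quadratic in blast\<close>)
    qed
  qed
  finally have E: "mutual_energy (distr M borel (\<lambda>x. x\<^sup>2 - c)) (distr M borel (\<lambda>x. x\<^sup>2 - c))
      = (\<integral>\<^sup>+x. \<integral>\<^sup>+y. ?k x y \<partial>M \<partial>M)" .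
  also have "\<dots> = mutual_energy M M + (\<integral>\<^sup>+x. \<integral>\<^sup>+y. kern x (- y) \<partial>M \<partial>M)"
    by (simp add: nn_integral_add mutual_energy_def)
  also have "(\<integral>\<^sup>+x. \<integral>\<^sup>+y. kern x (- y) \<partial>M \<partial>M) = mutual_energy M (distr M borel uminus)"
    unfolding mutual_energy_def by (intro nn_integral_cong nn_integral_distr_borel[symmetric]) measurable
  finally show "mutual_energy (distr M borel (\<lambda>x. x\<^sup>2 - c)) (distr M borel (\<lambda>x. x\<^sup>2 - c))
       = mutual_energy M M + mutual_energy M (distr M borel uminus)" .
  interpret S: real_distribution "symmetrize M" using real_distribution_symmetrize[OF M(1)] .
  have "2 * (2 * mutual_energy (symmetrize M) (symmetrize M))
      = 2 * (\<integral>\<^sup>+x. 2 * (\<integral>\<^sup>+y. kern x y \<partial>symmetrize M) \<partial>symmetrize M)"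
    unfolding mutual_energy_def by (subst nn_integral_cmult) measurable
  also have "\<dots> = 2 * (\<integral>\<^sup>+x. (\<integral>\<^sup>+y. ?k x y \<partial>M) \<partial>symmetrize M)"
    by (subst nn_integral_symmetrize[OF M(1)]) auto
  also have "\<dots> = (\<integral>\<^sup>+x. (\<integral>\<^sup>+y. ?k x y \<partial>M) + (\<integral>\<^sup>+y. ?k (- x) y \<partial>M) \<partial>M)"
    by (rule nn_integral_symmetrize[OF M(1)]) measurable
  also have "\<dots> = 2 * (\<integral>\<^sup>+x. \<integral>\<^sup>+y. ?k x y \<partial>M \<partial>M)"
    by (subst nn_integral_cmult[symmetric]) (auto simp: mult_2 add.commute)
  finally have "2 * mutual_energy (symmetrize M) (symmetrize M) = (\<integral>\<^sup>+x. \<integral>\<^sup>+y. ?k x y \<partial>M \<partial>M)"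
    by (subst (asm) ennreal_mult_cancel_left) auto
  with E show "mutual_energy (distr M borel (\<lambda>x. x\<^sup>2 - c)) (distr M borel (\<lambda>x. x\<^sup>2 - c))
       = 2 * mutual_energy (symmetrize M) (symmetrize M)" by simp
qed

lemma mutual_energy_reflect:
  assumes "real_distribution M"
  shows "mutual_energy (distr M borel uminus) (distr M borel uminus) = mutual_energy M M"
  by (subst mutual_energy_distr[OF assms assms]) (auto simp: mutual_energy_def)

locale symmetric_minimizer =
  fixes K :: "real set" and M :: "real measure"
  assumes minimizes: "minimizes_energy K M"
    and bounded: "K \<subseteq> {-1/2..1/2}"
    and symmetric: "\<And>x. x \<in> K \<Longrightarrow> - x \<in> K"
begin

lemma dist_M: "real_distribution M" and K_borel: "K \<in> sets borel" and AE_K: "AE x in M. x \<in> K"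
  and finite_energy: "mutual_energy M M < \<infinity>"
  using minimizes prob_measures_onD[of M K] by (auto simp: minimizes_energy_def)

lemma AE_bounded:
  assumes "AE x in N. x \<in> K"
  shows "AE x in N. \<bar>x\<bar> \<le> 1/2"
  using assms by (rule eventually_mono) (use bounded in \<open>force simp: abs_le_iff\<close>)

lemma symmetrize_on_K:
  assumes "real_distribution N" "AE x in N. x \<in> K"
  shows "symmetrize N \<in> prob_measures_on K"
  using assms symmetric
  by (intro prob_measures_onI real_distribution_symmetrize AE_symmetrize K_borel)
     (auto elim: eventually_mono)

text \<open>
  Symmetrizing cannot lower the energy of a minimizer, and the energy of the symmetrized measure
  is the mean of \<open>mutual_energy M M\<close> and the mutual energy with the reflection. Finiteness
  permits the cancellation.
\<close>

lemma energy_reflected: "mutual_energy M M \<le> mutual_energy M (distr M borel uminus)"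
proof -
  have "mutual_energy M M + mutual_energy M M \<le> 2 * mutual_energy (symmetrize M) (symmetrize M)"
    using minimizes symmetrize_on_K[OF dist_M AE_K]
    by (auto simp: minimizes_energy_def mult_2 intro!: add_mono)
  also have "\<dots> = mutual_energy M M + mutual_energy M (distr M borel uminus)"
    using mutual_energy_quadratic[OF dist_M AE_bounded[OF AE_K], of 0] by simp
  finally show ?thesis
    using finite_energy by (auto simp: ennreal_add_left_cancel_le less_top)
qed

text \<open>
  Combining minimality with strict positive definiteness; this plays the part of the uniqueness
  theorem for equilibrium measures.
\<close>

lemma reflection_invariant: "distr M borel uminus = M"
proof -
  have "M = distr M borel uminus"
  proof (rule eq_if_mutual_energy_ge)
    show "AE x in distr M borel uminus. \<bar>x\<bar> \<le> 1/2"
      using AE_K symmetric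
      by (intro AE_bounded, subst AE_distr_borel) (auto simp: dist_M K_borel elim: eventually_mono)
    show "mutual_energy M M + mutual_energy (distr M borel uminus) (distr M borel uminus)
        \<le> 2 * mutual_energy M (distr M borel uminus)"
      using energy_reflected by (simp add: mutual_energy_reflect[OF dist_M] mult_2 add_mono)
    show "mutual_energy M M + mutual_energy (distr M borel uminus) (distr M borel uminus) < \<infinity>"
      using finite_energy by (simp add: mutual_energy_reflect[OF dist_M])
    show "real_distribution (distr M borel uminus)"
      by (intro real_distribution_distr dist_M) measurable
  qed (fact dist_M AE_bounded[OF AE_K])+
  then show ?thesis by simp
qed

text \<open>
  A competitor on the image is pulled back by the positive square root and symmetrized. This halves
  its energy and lands in \<open>K\<close>, so minimality of \<open>M\<close> applies; symmetry of \<open>M\<close> gives equality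
  for the image of \<open>M\<close> itself.
\<close>

lemma minimizes_quadratic_image:
  assumes K': "(\<lambda>x. x\<^sup>2 - c) ` K \<in> sets borel"
  shows "minimizes_energy ((\<lambda>x. x\<^sup>2 - c) ` K) (distr M borel (\<lambda>x. x\<^sup>2 - c))"
    (is "minimizes_energy ?K' (distr M borel ?T)")
  unfolding minimizes_energy_def
proof (intro conjI ballI)
  note E = mutual_energy_quadratic[of _ c]
  have E_M: "mutual_energy (distr M borel ?T) (distr M borel ?T) = 2 * mutual_energy M M"
    by (simp add: E(1)[OF dist_M AE_bounded[OF AE_K]] reflection_invariant mult_2)
  show "distr M borel ?T \<in> prob_measures_on ?K'"
  proof (rule prob_measures_onI)
    show "real_distribution (distr M borel ?T)"
      by (intro real_distribution_distr dist_M) measurable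
    show "AE x in distr M borel ?T. x \<in> ?K'"
      using AE_K by (subst AE_distr_borel) (auto simp: dist_M K' elim: eventually_mono)
  qed (rule K')
  show "mutual_energy (distr M borel ?T) (distr M borel ?T) < \<infinity>"
    using finite_energy by (simp add: E_M ennreal_mult_less_top)
  fix N assume N: "N \<in> prob_measures_on ?K'"
  note dist_N = prob_measures_onD(1)[OF N] and AE_N = prob_measures_onD(3)[OF N]
  interpret N: real_distribution N by (rule dist_N)
  define S where "S = distr N borel (\<lambda>z. sqrt (z + c))"
  \<comment> \<open>Here $\sqrt{y^2} = |y|$, and \<open>K\<close> contains both signs.\<close>
  have sqrt: "sqrt (z + c) \<in> K \<and> (sqrt (z + c))\<^sup>2 - c = z" if "z \<in> ?K'" for z
    using that symmetric by (auto simp: abs_if)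
  have dist_S: "real_distribution S" unfolding S_def by (rule real_distribution_distr[OF dist_N]) measurable
  have AE_S: "AE x in S. x \<in> K"
    unfolding S_def using AE_N sqrt
    by (subst AE_distr_borel) (auto simp: dist_N K_borel elim!: eventually_mono)
  have "distr S borel ?T = distr N borel (\<lambda>z. (sqrt (z + c))\<^sup>2 - c)"
    unfolding S_def by (subst distr_distr) (auto simp: comp_def)
  also have "\<dots> = distr N borel (\<lambda>z. z)"
    using AE_N sqrt by (intro distr_cong_AE) (auto elim!: eventually_mono)
  also have "\<dots> = N" by (rule distr_id2) simp
  finally have "distr S borel ?T = N" .
  then have "mutual_energy N N = 2 * mutual_energy (symmetrize S) (symmetrize S)"
    using E(2)[OF dist_S AE_bounded[OF AE_S]] by simp
  also have "\<dots> \<ge> 2 * mutual_energy M M"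
    using minimizes symmetrize_on_K[OF dist_S AE_S]
    by (intro mult_left_mono) (auto simp: minimizes_energy_def)
  finally show "mutual_energy (distr M borel ?T) (distr M borel ?T) \<le> mutual_energy N N"
    by (simp add: E_M)
qed

end

section \<open>Equilibrium measures and the energy of measures on short intervals\<close>

text \<open>
  Distances at most 1 make the kernel nonnegative, so the subtracted integral vanishes.
\<close>

lemma log_energy_eq_mutual_energy:
  assumes M: "M \<in> prob_measures_on K" and K: "K \<subseteq> {a..a + 1}"
  shows "log_energy M = enn2ereal (mutual_energy M M)"
proof -
  note dist_M = prob_measures_onD(1)[OF M] and AE_M = prob_measures_onD(3)[OF M]
  have zero: "e2ennreal (- log_kernel x y) = 0" if "x \<in> K" "y \<in> K" for x y
  proof (cases "x = y")
    case False
    have "\<bar>x - y\<bar> \<le> 1" using subsetD[OF K that(1)] subsetD[OF K that(2)] by auto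
    then show ?thesis using False by (simp add: log_kernel_def dist_real_def ennreal_neg)
  qed (simp add: log_kernel_def e2ennreal_neg)
  have "(\<integral>\<^sup>+x. (\<integral>\<^sup>+y. e2ennreal (- log_kernel x y) \<partial>M) \<partial>M) = (\<integral>\<^sup>+x. 0 \<partial>M)"
  proof (rule nn_integral_cong_AE)
    show "AE x in M. (\<integral>\<^sup>+y. e2ennreal (- log_kernel x y) \<partial>M) = 0"
      using AE_M
    proof eventually_elim
      case (elim x)
      have "(\<integral>\<^sup>+y. e2ennreal (- log_kernel x y) \<partial>M) = (\<integral>\<^sup>+y. 0 \<partial>M)"
        by (rule nn_integral_cong_AE) (use AE_M in \<open>eventually_elim, use elim zero in blast\<close>)
      then show ?case by simp
    qed
  qed
  then show ?thesis
    by (simp add: log_energy_def mutual_energy_def kern_def zero_ennreal.rep_eq)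
qed

text \<open>
  Positive capacity says that the infimum of the energies is not $\infty$, so the minimizer has
  finite energy.
\<close>

lemma minimizes_energy_if_equilibrium:
  assumes K: "K \<subseteq> {a..a + 1}" and cap: "log_capacity K > 0" and eq: "is_equilibrium_measure K M"
  shows "minimizes_energy K M"
proof -
  have M: "M \<in> prob_measures_on K" and le: "\<And>N. N \<in> prob_measures_on K \<Longrightarrow> log_energy M \<le> log_energy N"
    using eq by (auto simp: is_equilibrium_measure_def)
  have "(INF N\<in>prob_measures_on K. log_energy N) \<noteq> \<infinity>"
    using cap by (auto simp: log_capacity_def Let_def)
  moreover have "log_energy M \<le> (INF N\<in>prob_measures_on K. log_energy N)"
    by (intro INF_greatest le)
  ultimately have "log_energy M \<noteq> \<infinity>" by auto
  then show ?thesis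
    using M le by (auto simp: minimizes_energy_def log_energy_eq_mutual_energy[OF _ K] less_top
        less_eq_ennreal.rep_eq)
qed

lemma minimizes_energy_translate:
  assumes min: "minimizes_energy K M" and K': "(\<lambda>x. x - d) ` K \<in> sets borel"
  shows "minimizes_energy ((\<lambda>x. x - d) ` K) (distr M borel (\<lambda>x. x - d))"
proof -
  have M: "M \<in> prob_measures_on K" and fin: "mutual_energy M M < \<infinity>"
    and le: "\<And>N. N \<in> prob_measures_on K \<Longrightarrow> mutual_energy M M \<le> mutual_energy N N"
    using min by (auto simp: minimizes_energy_def)
  have transl: "distr N borel (\<lambda>x. x - e) \<in> prob_measures_on B \<and>
      mutual_energy (distr N borel (\<lambda>x. x - e)) (distr N borel (\<lambda>x. x - e)) = mutual_energy N N"
    if N: "N \<in> prob_measures_on A" and B: "B \<in> sets borel" and AB: "\<And>x. x \<in> A \<Longrightarrow> x - e \<in> B" for N A B e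
  proof
    note dist_N = prob_measures_onD(1)[OF N]
    show "distr N borel (\<lambda>x. x - e) \<in> prob_measures_on B"
    proof (rule prob_measures_onI)
      show "real_distribution (distr N borel (\<lambda>x. x - e))"
        by (intro real_distribution_distr dist_N) measurable
      show "AE x in distr N borel (\<lambda>x. x - e). x \<in> B"
        using prob_measures_onD(3)[OF N] AB
        by (subst AE_distr_borel) (auto simp: dist_N B elim: eventually_mono)
    qed (rule B)
    have "kern (x - e) (y - e) = kern x y" for x y by (simp add: kern_eq)
    then show "mutual_energy (distr N borel (\<lambda>x. x - e)) (distr N borel (\<lambda>x. x - e)) = mutual_energy N N"
      by (subst mutual_energy_distr) (auto simp: dist_N mutual_energy_def)
  qed
  have K: "K \<in> sets borel" using prob_measures_onD(2)[OF M] .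
  show ?thesis
    unfolding minimizes_energy_def
  proof (intro conjI ballI)
    show "distr M borel (\<lambda>x. x - d) \<in> prob_measures_on ((\<lambda>x. x - d) ` K)"
      "mutual_energy (distr M borel (\<lambda>x. x - d)) (distr M borel (\<lambda>x. x - d)) < \<infinity>"
      using transl[OF M K', of d] fin by auto
    fix N assume N: "N \<in> prob_measures_on ((\<lambda>x. x - d) ` K)"
    have "x - - d \<in> K" if "x \<in> (\<lambda>x. x - d) ` K" for x using that by auto
    note shifted_back = transl[OF N K this]
    have "mutual_energy (distr M borel (\<lambda>x. x - d)) (distr M borel (\<lambda>x. x - d)) = mutual_energy M M"
      using transl[OF M K', of d] by simp
    also have "\<dots> \<le> mutual_energy N N"
      using le[OF conjunct1[OF shifted_back]] conjunct2[OF shifted_back] by simp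
    finally show "mutual_energy (distr M borel (\<lambda>x. x - d)) (distr M borel (\<lambda>x. x - d)) \<le> mutual_energy N N" .
  qed
qed

text \<open>
  An atom of mass \<open>m\<close> contributes $\infty \cdot m^2$, because the kernel is $\infty$ on the diagonal.
\<close>

lemma no_atoms_if_finite_energy:
  assumes M: "real_distribution M" and fin: "mutual_energy M M < \<infinity>"
  shows "emeasure M {a} = 0"
proof (rule ccontr)
  interpret real_distribution M by fact
  assume pos: "emeasure M {a} \<noteq> 0"
  have "(\<integral>\<^sup>+x. \<integral>\<^sup>+y. \<infinity> * (indicator {a} x * indicator {a} y) \<partial>M \<partial>M) = \<infinity> * (emeasure M {a} * emeasure M {a})"
    by (simp add: nn_integral_cmult nn_integral_multc)
  also have "\<dots> = \<infinity>" using pos by (simp add: ennreal_top_mult)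
  finally have "\<infinity> = (\<integral>\<^sup>+x. \<integral>\<^sup>+y. \<infinity> * (indicator {a} x * indicator {a} y) \<partial>M \<partial>M)" by simp
  also have "\<dots> \<le> mutual_energy M M"
    unfolding mutual_energy_def
    by (intro nn_integral_mono) (auto simp: kern_eq indicator_def)
  finally show False using fin by (simp add: top_unique)
qed

section \<open>The polynomials, their fibres and the Chebyshev property\<close>

locale gamma_sequence =
  fixes \<gamma> :: "nat \<Rightarrow> real"
  assumes gamma: "\<And>k. k \<ge> 1 \<Longrightarrow> 0 < \<gamma> k \<and> \<gamma> k < 1/4"
begin

abbreviation r :: "nat \<Rightarrow> real" where
  "r \<equiv> r_seq \<gamma>"

text \<open>
  Half the length of the interval of values on $E_s$ is added to centre that interval at 0; this is what
  turns the recursion into a square minus a constant.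
\<close>

definition F :: "nat \<Rightarrow> real poly" where
  "F s = P_pow2 \<gamma> s + [:r s / 2:]"

definition c :: "nat \<Rightarrow> real" where
  "c s = (r s)\<^sup>2 / 4 - r (Suc s) / 2"

lemma r_pos: "0 < r s"
  by (induction s) (use gamma in auto)

lemma r_Suc_less: "r (Suc s) < (r s)\<^sup>2 / 4"
  using gamma[of "Suc s"] r_pos[of s] by (simp add: field_simps)

declare r_seq.simps(2) [simp del]

lemma r_le_1: "r s \<le> 1"
proof (induction s)
  case (Suc s)
  have "(r s)\<^sup>2 \<le> 1" using Suc r_pos[of s] by (simp add: power_le_one)
  with r_Suc_less[of s] show ?case by linarith
qed simp

lemma F_Suc: "F (Suc s) = (F s)\<^sup>2 - [:c s:]"
proof -
  have "poly (F (Suc s)) = poly ((F s)\<^sup>2 - [:c s:])"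
    by (rule ext) (simp add: F_def c_def power2_eq_square field_simps)
  then show ?thesis by (simp only: poly_eq_poly_eq_iff)
qed

lemma poly_F_Suc: "poly (F (Suc s)) x = (poly (F s) x)\<^sup>2 - c s"
  by (simp add: F_Suc)

lemma degree_F: "degree (F s) = 2 ^ s" and lead_coeff_F: "lead_coeff (F s) = 1"
proof -
  have "degree (F s) = 2 ^ s \<and> lead_coeff (F s) = 1"
  proof (induction s)
    case 0
    show ?case by (simp add: F_def)
  next
    case (Suc s)
    then have "F s \<noteq> 0" by auto
    with Suc have F: "degree ((F s)\<^sup>2) = 2 ^ Suc s" "lead_coeff ((F s)\<^sup>2) = 1"
      by (simp add: power2_eq_square degree_mult_eq, metis Suc lead_coeff_power power_one)
    have "degree (F (Suc s)) = degree ((F s)\<^sup>2)"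
      unfolding F_Suc diff_conv_add_uminus using F(1) by (intro degree_add_eq_left) simp
    then show ?case using F unfolding F_Suc by (simp add: coeff_pCons split: nat.split)
  qed
  then show "degree (F s) = 2 ^ s" "lead_coeff (F s) = 1" by auto
qed

lemma F_nonzero: "F s \<noteq> 0"
  using lead_coeff_F[of s] by auto

lemma E_set_eq: "E_set \<gamma> s = {x. \<bar>poly (F s) x\<bar> \<le> r s / 2}"
proof -
  have "poly (P_pow2 \<gamma> (Suc s)) x \<le> 0 \<longleftrightarrow> \<bar>poly (F s) x\<bar> \<le> r s / 2" for x
  proof -
    have "poly (P_pow2 \<gamma> (Suc s)) x = (poly (F s) x)\<^sup>2 - (r s / 2)\<^sup>2"
      by (simp add: F_def power2_eq_square field_simps)
    then show ?thesis using r_pos[of s] by (simp add: abs_le_square_iff[symmetric])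
  qed
  then show ?thesis by (simp add: E_set_def)
qed

lemma cantor_K_eq: "cantor_K \<gamma> = {x. \<forall>s. \<bar>poly (F s) x\<bar> \<le> r s / 2}"
  by (auto simp: cantor_K_def E_set_eq)

text \<open>
  The inclusion $E_{s+1} \subseteq E_s$: the bound on $F_{s+1} = F_s^2 - c_s$ gives
  $F_s^2 \le c_s + r_{s+1}/2 = r_s^2/4$.
\<close>

lemma F_bound_decreasing:
  assumes "\<bar>poly (F t) x\<bar> \<le> r t / 2" "s \<le> t"
  shows "\<bar>poly (F s) x\<bar> \<le> r s / 2"
  using assms(2,1)
proof (induction rule: inc_induct)
  case (step n)
  then have "\<bar>(poly (F n) x)\<^sup>2 - ((r n)\<^sup>2 / 4 - r (Suc n) / 2)\<bar> \<le> r (Suc n) / 2"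
    by (simp add: poly_F_Suc c_def)
  then have "(poly (F n) x)\<^sup>2 \<le> (r n)\<^sup>2 / 4" by linarith
  then have "(poly (F n) x)\<^sup>2 \<le> (r n / 2)\<^sup>2" by (simp add: power_divide)
  then show ?case using r_pos[of n] by (simp add: abs_le_square_iff[symmetric])
qed

lemma F_eq_after_sign:
  assumes "poly (F s) y = poly (F s) x \<or> poly (F s) y = - poly (F s) x" "s < t"
  shows "poly (F t) y = poly (F t) x"
proof -
  have "Suc s \<le> t" using assms(2) by simp
  then show ?thesis
  proof (induction rule: dec_induct)
    case base
    show ?case using assms(1) by (auto simp: poly_F_Suc)
  next
    case (step n)
    then show ?case by (simp add: poly_F_Suc)
  qed
qed

text \<open>
  From level \<open>s + 1\<close> on, the defining inequalities only see $F_s^2$, and they imply those at the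
  lower levels.
\<close>

lemma cantor_K_fibre:
  assumes "x \<in> cantor_K \<gamma>" "poly (F s) y = poly (F s) x \<or> poly (F s) y = - poly (F s) x"
  shows "y \<in> cantor_K \<gamma>"
proof -
  have "\<bar>poly (F t) y\<bar> \<le> r t / 2" if "s \<le> t" for t
    using assms F_eq_after_sign[OF assms(2), of t] that by (cases "t = s") (auto simp: cantor_K_eq)
  then have "\<bar>poly (F t) y\<bar> \<le> r t / 2" for t
    using F_bound_decreasing[of "max s t" y t] by simp
  then show ?thesis by (simp add: cantor_K_eq)
qed

text \<open>
  The constant $c_s$ is such that $r_s^2/4 - c_s = r_{s+1}/2$.
\<close>

lemma F_endpoint_iterate:
  assumes "\<bar>poly (F s) x\<bar> = r s / 2" "s \<le> t"
  shows "\<bar>poly (F t) x\<bar> = r t / 2"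
  using assms(2,1)
proof (induction rule: dec_induct)
  case (step n)
  then have "(poly (F n) x)\<^sup>2 = (r n / 2)\<^sup>2" by (metis power2_abs)
  then show ?case using r_pos[of "Suc n"] by (simp add: poly_F_Suc c_def power_divide)
qed

lemma endpoint_in_cantor_K:
  assumes "\<bar>poly (F s) x\<bar> = r s / 2"
  shows "x \<in> cantor_K \<gamma>"
proof -
  have "\<bar>poly (F t) x\<bar> \<le> r t / 2" for t
    using F_endpoint_iterate[OF assms, of "max s t"] F_bound_decreasing[of "max s t" x t] by simp
  then show ?thesis by (simp add: cantor_K_eq)
qed

definition fibre :: "nat \<Rightarrow> real \<Rightarrow> real set" where
  "fibre s a = {x. poly (F s) x = a}"

lemma finite_fibre: "finite (fibre s a)"
proof -
  have "F s - [:a:] \<noteq> 0"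
  proof
    assume "F s - [:a:] = 0"
    then have "degree (F s) = degree [:a:]" by simp
    then show False by (simp add: degree_F)
  qed
  then have "finite {x. poly (F s - [:a:]) x = 0}" by (rule poly_roots_finite)
  then show ?thesis by (simp add: fibre_def)
qed

text \<open>
  The bound $\gamma_{s+1} < 1/4$ enters here: it makes $a + c_s$ positive, so that the fibre
  splits into two disjoint fibres one level lower.
\<close>

lemma fibre_Suc:
  assumes "\<bar>a\<bar> \<le> r (Suc s) / 2"
  obtains b where "0 < b" "b \<le> r s / 2" "fibre (Suc s) a = fibre s b \<union> fibre s (- b)"
proof
  let ?b = "sqrt (a + c s)"
  have pos: "0 < a + c s" using assms r_Suc_less[of s] by (simp add: c_def abs_le_iff)
  then show "0 < ?b" by simp
  have "a + c s \<le> (r s / 2)\<^sup>2" using assms by (simp add: c_def power_divide)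
  then show "?b \<le> r s / 2" using r_pos[of s] by (intro real_le_lsqrt) auto
  have "y\<^sup>2 - c s = a \<longleftrightarrow> y = ?b \<or> y = - ?b" for y
  proof -
    have "y\<^sup>2 - c s = a \<longleftrightarrow> y\<^sup>2 = ?b\<^sup>2" using pos by auto
    then show ?thesis by (simp only: power2_eq_iff)
  qed
  then show "fibre (Suc s) a = fibre s ?b \<union> fibre s (- ?b)"
    by (auto simp: fibre_def poly_F_Suc)
qed

lemma sum_fibre_Suc:
  assumes "\<bar>a\<bar> \<le> r (Suc s) / 2"
  obtains b where "0 < b" "b \<le> r s / 2"
    "\<And>f. (\<Sum>x\<in>fibre (Suc s) a. f x :: real) = (\<Sum>x\<in>fibre s b. f x) + (\<Sum>x\<in>fibre s (- b). f x)"
proof -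
  obtain b where b: "0 < b" "b \<le> r s / 2" "fibre (Suc s) a = fibre s b \<union> fibre s (- b)"
    using fibre_Suc[OF assms] .
  show ?thesis
  proof (rule that[OF b(1,2)])
    fix f :: "real \<Rightarrow> real"
    have "fibre s b \<inter> fibre s (- b) = {}" using b(1) by (auto simp: fibre_def)
    then show "(\<Sum>x\<in>fibre (Suc s) a. f x) = (\<Sum>x\<in>fibre s b. f x) + (\<Sum>x\<in>fibre s (- b). f x)"
      unfolding b(3) by (intro sum.union_disjoint finite_fibre)
  qed
qed

lemma fibre_0: "fibre 0 a = {a + 1/2}"
  by (auto simp: fibre_def F_def)

lemma card_fibre: "\<bar>a\<bar> \<le> r s / 2 \<Longrightarrow> card (fibre s a) = 2 ^ s"
proof (induction s arbitrary: a)
  case 0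
  show ?case by (simp add: fibre_0)
next
  case (Suc s)
  obtain b where b: "0 < b" "b \<le> r s / 2"
    "(\<Sum>x\<in>fibre (Suc s) a. 1 :: real) = (\<Sum>x\<in>fibre s b. 1) + (\<Sum>x\<in>fibre s (- b). 1)"
    using sum_fibre_Suc[OF Suc.prems, of thesis] by blast
  then have "card (fibre (Suc s) a) = card (fibre s b) + card (fibre s (- b))"
    by (simp flip: of_nat_add)
  then show ?case using b(1,2) Suc.IH[of b] Suc.IH[of "- b"] by simp
qed

lemma division_by_F:
  assumes "degree p < 2 ^ Suc s"
  obtains A B where "p = F s * A + B" "degree A < 2 ^ s" "degree B < 2 ^ s"
proof
  let ?A = "p div F s" and ?B = "p mod F s"
  show p: "p = F s * ?A + ?B" by simp
  show B: "degree ?B < 2 ^ s"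
    using degree_mod_less[OF F_nonzero, of p s] by (auto simp: degree_F)
  show "degree ?A < 2 ^ s"
  proof (cases "?A = 0")
    case False
    then have "degree (F s * ?A) = 2 ^ s + degree ?A"
      by (simp add: degree_mult_eq F_nonzero degree_F)
    moreover from this have "degree p = degree (F s * ?A)"
      using B by (subst p) (intro degree_add_eq_left, simp)
    ultimately show ?thesis using assms by simp
  qed simp
qed

text \<open>
  Write $p = F_s A + B$. The fibre at level \<open>s + 1\<close> consists of those over \<open>b\<close> and \<open>- b\<close>; by
  the induction hypothesis the terms $b \sum A$ and $-b \sum A$ cancel and the two sums of \<open>B\<close>
  agree with a constant.
\<close>

lemma sum_fibre_constant:
  "degree p < 2 ^ s \<Longrightarrow> \<exists>C. \<forall>a. \<bar>a\<bar> \<le> r s / 2 \<longrightarrow> (\<Sum>x\<in>fibre s a. poly p x) = C"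
proof (induction s arbitrary: p)
  case 0
  then obtain k where "p = [:k:]" by (auto elim: degree_eq_zeroE)
  then show ?case by (auto simp: fibre_0)
next
  case (Suc s)
  obtain A B where AB: "p = F s * A + B" "degree A < 2 ^ s" "degree B < 2 ^ s"
    using division_by_F[OF Suc.prems] .
  obtain CA CB where C: "\<And>a. \<bar>a\<bar> \<le> r s / 2 \<Longrightarrow> (\<Sum>x\<in>fibre s a. poly A x) = CA"
    "\<And>a. \<bar>a\<bar> \<le> r s / 2 \<Longrightarrow> (\<Sum>x\<in>fibre s a. poly B x) = CB"
    using Suc.IH[OF AB(2)] Suc.IH[OF AB(3)] by metis
  have level: "(\<Sum>x\<in>fibre s a. poly p x) = a * CA + CB" if "\<bar>a\<bar> \<le> r s / 2" for a
  proof -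
    have "(\<Sum>x\<in>fibre s a. poly p x) = (\<Sum>x\<in>fibre s a. a * poly A x + poly B x)"
      by (intro sum.cong) (auto simp: AB(1) fibre_def)
    then show ?thesis using C that by (simp add: sum.distrib sum_distrib_left[symmetric])
  qed
  have "(\<Sum>x\<in>fibre (Suc s) a. poly p x) = 2 * CB" if a: "\<bar>a\<bar> \<le> r (Suc s) / 2" for a
  proof -
    obtain b where b: "0 < b" "b \<le> r s / 2"
      "(\<Sum>x\<in>fibre (Suc s) a. poly p x) = (\<Sum>x\<in>fibre s b. poly p x) + (\<Sum>x\<in>fibre s (- b). poly p x)"
      using sum_fibre_Suc[OF a, of thesis] by blast
    then show ?thesis using level[of b] level[of "- b"] by simp
  qed
  then show ?case by blast
qed

lemma compact_cantor_K: "compact (cantor_K \<gamma>)" and cantor_K_subset: "cantor_K \<gamma> \<subseteq> {0..1}"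
proof -
  show sub: "cantor_K \<gamma> \<subseteq> {0..1}"
  proof
    fix x assume "x \<in> cantor_K \<gamma>"
    then have "\<bar>poly (F 0) x\<bar> \<le> r 0 / 2" unfolding cantor_K_eq by blast
    then have "\<bar>x - 1/2\<bar> \<le> 1/2" by (simp add: F_def)
    then have "0 \<le> x \<and> x \<le> 1" by linarith
    then show "x \<in> {0..1}" by simp
  qed
  have "closed (cantor_K \<gamma>)"
    unfolding cantor_K_def E_set_eq
    by (intro closed_INT ballI closed_Collect_le continuous_intros)
  then show "compact (cantor_K \<gamma>)"
    using bounded_subset[OF bounded_closed_interval sub] by (simp add: compact_eq_bounded_closed)
qed

lemma degree_monic_diff:
  assumes "degree (q :: real poly) = 2 ^ s" "lead_coeff q = 1"
  shows "degree (q - F s) < 2 ^ s"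
proof -
  have "degree (q - F s) \<le> 2 ^ s"
    using degree_diff_le[of q "2 ^ s" "F s"] assms by (simp add: degree_F)
  moreover have "coeff (q - F s) (2 ^ s) = 0"
    using assms lead_coeff_F[of s] by (simp add: degree_F)
  ultimately have "degree (q - F s) \<noteq> 2 ^ s \<or> q - F s = 0"
    using leading_coeff_0_iff[of "q - F s"] by auto
  with \<open>degree (q - F s) \<le> 2 ^ s\<close> show ?thesis by (auto simp del: right_minus_eq)
qed

lemma poly_zero_if_zero_on_fibre:
  assumes "degree p < 2 ^ s" "\<bar>a\<bar> \<le> r s / 2" "\<And>x. x \<in> fibre s a \<Longrightarrow> poly p x = 0"
  shows "p = 0"
proof (rule ccontr)
  assume "p \<noteq> 0"
  then have "card (fibre s a) \<le> card {x. poly p x = 0}"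
    using assms(3) by (intro card_mono poly_roots_finite) auto
  also have "\<dots> \<le> degree p" using \<open>p \<noteq> 0\<close> by (rule card_poly_roots_bound)
  finally show False using assms(1,2) by (simp add: card_fibre)
qed

lemma abs_poly_le_sup_norm:
  assumes "x \<in> cantor_K \<gamma>"
  shows "\<bar>poly p x\<bar> \<le> sup_norm_on (cantor_K \<gamma>) p"
  unfolding sup_norm_on_def
proof (rule cSUP_upper[OF assms])
  have "compact ((\<lambda>x. \<bar>poly p x\<bar>) ` cantor_K \<gamma>)"
    by (intro compact_continuous_image compact_cantor_K continuous_intros)
  then show "bdd_above ((\<lambda>x. \<bar>poly p x\<bar>) ` cantor_K \<gamma>)"
    by (intro bounded_imp_bdd_above compact_imp_bounded)
qed

lemma fibre_endpoints_subset:
  "fibre s (r s / 2) \<subseteq> cantor_K \<gamma>" "fibre s (- (r s / 2)) \<subseteq> cantor_K \<gamma>"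
  using r_pos[of s] by (auto simp: fibre_def intro!: endpoint_in_cantor_K[of s])

lemma sup_norm_F: "sup_norm_on (cantor_K \<gamma>) (F s) \<le> r s / 2"
proof -
  have "fibre s (r s / 2) \<noteq> {}"
    using card_fibre[of "r s / 2" s] r_pos[of s] by fastforce
  then have "cantor_K \<gamma> \<noteq> {}" using fibre_endpoints_subset by blast
  then show ?thesis
    unfolding sup_norm_on_def by (rule cSUP_least) (auto simp: cantor_K_eq)
qed

text \<open>
  The difference $q - F_s$ has degree below $2^s$ and drops out, so only the contribution of $F_s$
  remains. The signed fibre sum acts as a dual certificate for the minimal sup norm.
\<close>

lemma signed_fibre_sum:
  assumes "degree q = 2 ^ s" "lead_coeff q = 1"
  shows "(\<Sum>x\<in>fibre s (r s / 2). poly q x) - (\<Sum>x\<in>fibre s (- (r s / 2)). poly q x) = 2 ^ s * r s"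
proof -
  let ?a = "r s / 2"
  obtain C where C: "\<And>a. \<bar>a\<bar> \<le> r s / 2 \<Longrightarrow> (\<Sum>x\<in>fibre s a. poly (q - F s) x) = C"
    using sum_fibre_constant[OF degree_monic_diff[OF assms]] by blast
  have level: "(\<Sum>x\<in>fibre s a. poly q x) = 2 ^ s * a + C" if "\<bar>a\<bar> \<le> r s / 2" for a
  proof -
    have "(\<Sum>x\<in>fibre s a. poly q x) = (\<Sum>x\<in>fibre s a. a + poly (q - F s) x)"
      by (intro sum.cong) (auto simp: fibre_def)
    also have "\<dots> = 2 ^ s * a + C"
      unfolding sum.distrib C[OF that] using card_fibre[OF that] by simp
    finally show ?thesis .
  qed
  show ?thesis using r_pos[of s] level[of ?a] level[of "- ?a"] by simp
qed

lemma sup_norm_lower_bound: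
  assumes "degree q = 2 ^ s" "lead_coeff q = 1"
  shows "r s / 2 \<le> sup_norm_on (cantor_K \<gamma>) q"
proof -
  let ?a = "r s / 2" and ?m = "sup_norm_on (cantor_K \<gamma>) q"
  have up: "(\<Sum>x\<in>fibre s ?a. poly q x) \<le> (\<Sum>x\<in>fibre s ?a. ?m)"
    using fibre_endpoints_subset(1) abs_poly_le_sup_norm by (intro sum_mono) (meson abs_le_D1 subsetD)
  have down: "(\<Sum>x\<in>fibre s (- ?a). - ?m) \<le> (\<Sum>x\<in>fibre s (- ?a). poly q x)"
    using fibre_endpoints_subset(2) abs_poly_le_sup_norm
    by (intro sum_mono) (meson abs_le_D2 minus_le_iff subsetD)
  have "(\<Sum>x\<in>fibre s ?a. ?m) = 2 ^ s * ?m" "(\<Sum>x\<in>fibre s (- ?a). - ?m) = - (2 ^ s * ?m)"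
    using r_pos[of s] by (simp_all add: card_fibre)
  with up down signed_fibre_sum[OF assms] have "2 ^ s * r s \<le> 2 ^ s * (2 * ?m)"
    by linarith
  then show ?thesis by simp
qed

text \<open>
  At the optimal norm every summand of the signed fibre sum must be extremal, so $q$ agrees with $F_s$
  on a fibre of $2^s$ points.
\<close>

lemma eq_F_if_sup_norm_le:
  assumes q: "degree q = 2 ^ s" "lead_coeff q = 1"
    and le: "sup_norm_on (cantor_K \<gamma>) q \<le> r s / 2"
  shows "q = F s"
proof -
  let ?a = "r s / 2"
  have bound: "\<bar>poly q x\<bar> \<le> ?a" if "x \<in> cantor_K \<gamma>" for x
    using abs_poly_le_sup_norm[OF that] le by (rule order_trans)
  have nonneg: "0 \<le> ?a - poly q x" if "x \<in> fibre s ?a" for x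
    using bound[of x] fibre_endpoints_subset(1)[of s] that by (auto simp: abs_le_iff)
  have nonneg': "0 \<le> poly q x + ?a" if "x \<in> fibre s (- ?a)" for x
    using bound[of x] fibre_endpoints_subset(2)[of s] that by (auto simp: abs_le_iff)
  have "(\<Sum>x\<in>fibre s ?a. ?a - poly q x) + (\<Sum>x\<in>fibre s (- ?a). poly q x + ?a) = 0"
    using signed_fibre_sum[OF q] r_pos[of s]
    by (simp add: sum.distrib sum_subtractf card_fibre algebra_simps)
  moreover have "0 \<le> (\<Sum>x\<in>fibre s ?a. ?a - poly q x)" "0 \<le> (\<Sum>x\<in>fibre s (- ?a). poly q x + ?a)"
    using nonneg nonneg' by (auto intro!: sum_nonneg)
  ultimately have "(\<Sum>x\<in>fibre s ?a. ?a - poly q x) = 0" by linarith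
  then have attained: "poly q x = ?a" if "x \<in> fibre s ?a" for x
    using nonneg that finite_fibre[of s ?a] by (subst (asm) sum_nonneg_eq_0_iff) auto
  have "poly (q - F s) x = 0" if "x \<in> fibre s ?a" for x
    using attained[OF that] that by (simp add: fibre_def)
  then have "q - F s = 0"
    using r_pos[of s] by (intro poly_zero_if_zero_on_fibre[of _ s ?a] degree_monic_diff q) auto
  then show ?thesis by simp
qed

lemma is_chebyshev_iff: "is_chebyshev_poly (cantor_K \<gamma>) (2 ^ s) T \<longleftrightarrow> T = F s"
proof
  assume T: "is_chebyshev_poly (cantor_K \<gamma>) (2 ^ s) T"
  then have "sup_norm_on (cantor_K \<gamma>) T \<le> sup_norm_on (cantor_K \<gamma>) (F s)"
    using degree_F lead_coeff_F by (simp add: is_chebyshev_poly_def)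
  also have "\<dots> \<le> r s / 2" by (rule sup_norm_F)
  finally show "T = F s" using T by (intro eq_F_if_sup_norm_le) (auto simp: is_chebyshev_poly_def)
next
  assume "T = F s"
  then show "is_chebyshev_poly (cantor_K \<gamma>) (2 ^ s) T"
    using order_trans[OF sup_norm_F sup_norm_lower_bound] degree_F lead_coeff_F
    by (auto simp: is_chebyshev_poly_def)
qed

end

section \<open>Orthogonality with respect to the equilibrium measure\<close>

locale cantor_equilibrium = gamma_sequence \<gamma> for \<gamma> +
  fixes \<mu> :: "real measure"
  assumes minimizes: "minimizes_energy (cantor_K \<gamma>) \<mu>"
begin

lemma dist_\<mu>: "real_distribution \<mu>"
  and AE_\<mu>: "AE x in \<mu>. x \<in> cantor_K \<gamma>"
  and finite_energy: "mutual_energy \<mu> \<mu> < \<infinity>"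
  using minimizes prob_measures_onD[of \<mu> "cantor_K \<gamma>"] by (auto simp: minimizes_energy_def)

sublocale real_distribution \<mu> by (rule dist_\<mu>)

definition level_measure :: "nat \<Rightarrow> real measure" where
  "level_measure s = distr \<mu> borel (poly (F s))"

definition level_set :: "nat \<Rightarrow> real set" where
  "level_set s = poly (F s) ` cantor_K \<gamma>"

lemma measurable_poly [measurable]: "poly p \<in> borel_measurable (borel :: real measure)"
  by (intro borel_measurable_continuous_onI continuous_intros)

lemma level_set_borel: "level_set s \<in> sets borel"
  unfolding level_set_def
  by (intro borel_compact compact_continuous_image compact_cantor_K continuous_intros)

lemma level_set_bounded: "level_set s \<subseteq> {-1/2..1/2}"
proof
  fix y assume "y \<in> level_set s"
  then have "\<bar>y\<bar> \<le> r s / 2" by (auto simp: level_set_def cantor_K_eq)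
  with r_le_1[of s] show "y \<in> {-1/2..1/2}" by (auto simp: abs_le_iff)
qed

lemma level_set_symmetric:
  assumes "y \<in> level_set s"
  shows "- y \<in> level_set s"
proof -
  obtain x where x: "x \<in> cantor_K \<gamma>" "y = poly (F s) x"
    using assms by (auto simp: level_set_def)
  then have "\<bar>- y\<bar> \<le> r s / 2" by (auto simp: cantor_K_eq)
  then have "card (fibre s (- y)) > 0" by (simp add: card_fibre)
  then obtain z where "poly (F s) z = - y" by (auto simp: card_gt_0_iff fibre_def)
  moreover from this have "z \<in> cantor_K \<gamma>" using cantor_K_fibre x by blast
  ultimately show ?thesis by (force simp: level_set_def)
qed

text \<open>
  Induction along $F_{s+1} = F_s^2 - c_s$. All levels stay inside $[-1/2, 1/2]$ because
  $r_s \le 1$, so the energy remains nonnegative at each step.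
\<close>

lemma symmetric_minimizer_level: "symmetric_minimizer (level_set s) (level_measure s)"
proof -
  have "minimizes_energy (level_set s) (level_measure s)"
  proof (induction s)
    case 0
    have "poly (F 0) = (\<lambda>x. x - 1/2)" by (rule ext) (simp add: F_def)
    then show ?case
      using minimizes_energy_translate[OF minimizes, of "1/2"] level_set_borel[of 0]
      by (simp add: level_set_def level_measure_def)
  next
    case (Suc s)
    interpret symmetric_minimizer "level_set s" "level_measure s"
      by unfold_locales (use Suc level_set_bounded level_set_symmetric in auto)
    have set: "(\<lambda>x. x\<^sup>2 - c s) ` level_set s = level_set (Suc s)"
      by (simp add: level_set_def image_image poly_F_Suc)
    have measure: "distr (level_measure s) borel (\<lambda>x. x\<^sup>2 - c s) = level_measure (Suc s)"
      unfolding level_measure_def by (subst distr_distr) (auto simp: comp_def poly_F_Suc[abs_def])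
    show ?case
      using minimizes_quadratic_image[of "c s"] level_set_borel[of "Suc s"] unfolding set measure .
  qed
  then show ?thesis
    by unfold_locales (use level_set_bounded level_set_symmetric in auto)
qed

lemma integral_odd_F: "(\<integral>x. poly (F s) x * poly h ((poly (F s) x)\<^sup>2) \<partial>\<mu>) = 0"
proof -
  interpret symmetric_minimizer "level_set s" "level_measure s"
    by (rule symmetric_minimizer_level)
  let ?g = "\<lambda>y. y * poly h (y\<^sup>2)"
  interpret N: real_distribution "level_measure s" by (rule dist_M)
  have "(\<integral>y. ?g y \<partial>level_measure s) = (\<integral>y. ?g y \<partial>distr (level_measure s) borel uminus)"
    by (simp only: reflection_invariant)
  also have "\<dots> = (\<integral>y. ?g (- y) \<partial>level_measure s)"
    by (intro integral_distr) measurable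
  also have "\<dots> = - (\<integral>y. ?g y \<partial>level_measure s)" by simp
  finally have "(\<integral>y. ?g y \<partial>level_measure s) = 0" by simp
  moreover have "(\<integral>y. ?g y \<partial>level_measure s) = (\<integral>x. ?g (poly (F s) x) \<partial>\<mu>)"
    unfolding level_measure_def by (intro integral_distr) measurable
  ultimately show ?thesis by simp
qed

lemma integrable_poly: "integrable \<mu> (poly p)"
proof -
  have "compact (poly p ` cantor_K \<gamma>)"
    by (intro compact_continuous_image compact_cantor_K continuous_intros)
  then have "bounded (poly p ` cantor_K \<gamma>)" by (rule compact_imp_bounded)
  then obtain b where b: "\<And>x. x \<in> cantor_K \<gamma> \<Longrightarrow> norm (poly p x) \<le> b"
    unfolding bounded_iff by blast
  show ?thesis
    by (rule integrable_const_bound[of _ b]) (use AE_\<mu> b in \<open>auto elim: eventually_mono\<close>)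
qed

lemma integrable_poly_mult: "integrable \<mu> (\<lambda>x. poly p x * poly q x)"
  using integrable_poly[of "p * q"] by (simp only: poly_mult[abs_def])

lemma integrable_poly_mult_comp: "integrable \<mu> (\<lambda>x. poly p x * poly g (poly q x))"
  using integrable_poly_mult[of p "g \<circ>\<^sub>p q"] by (simp only: poly_pcompose)

text \<open>
  In $p = F_s A + B$ the term with \<open>A\<close> leads, by the induction hypothesis, to the integral of an
  odd polynomial in $F_s$, which vanishes. Functions of $F_{s+1}$ are therefore uncorrelated
  with polynomials of degree below $2^{s+1}$: the constant does not depend on \<open>g\<close>.
\<close>

lemma integral_low_degree_factor:
  "degree p < 2 ^ s \<Longrightarrow>
     \<exists>C. \<forall>g. (\<integral>x. poly p x * poly g (poly (F s) x) \<partial>\<mu>) = C * (\<integral>x. poly g (poly (F s) x) \<partial>\<mu>)"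
proof (induction s arbitrary: p)
  case 0
  then obtain k where "p = [:k:]" by (auto elim: degree_eq_zeroE)
  then show ?case by auto
next
  case (Suc s)
  obtain A B where AB: "p = F s * A + B" "degree A < 2 ^ s" "degree B < 2 ^ s"
    using division_by_F[OF Suc.prems] .
  obtain CA where CA: "\<And>g. (\<integral>x. poly A x * poly g (poly (F s) x) \<partial>\<mu>) = CA * (\<integral>x. poly g (poly (F s) x) \<partial>\<mu>)"
    using Suc.IH[OF AB(2)] by blast
  obtain CB where CB: "\<And>g. (\<integral>x. poly B x * poly g (poly (F s) x) \<partial>\<mu>) = CB * (\<integral>x. poly g (poly (F s) x) \<partial>\<mu>)"
    using Suc.IH[OF AB(3)] by blast
  have "(\<integral>x. poly p x * poly g (poly (F (Suc s)) x) \<partial>\<mu>) = CB * (\<integral>x. poly g (poly (F (Suc s)) x) \<partial>\<mu>)" for g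
  proof -
    define g0 where "g0 = g \<circ>\<^sub>p [:- c s, 1:]"
    define g1 where "g1 = g0 \<circ>\<^sub>p [:0, 0, 1:]"
    have g0: "poly g0 (y\<^sup>2) = poly g (y\<^sup>2 - c s)" for y
      by (simp add: g0_def poly_pcompose)
    have g1: "poly g1 y = poly g (y\<^sup>2 - c s)" for y
      by (simp add: g1_def g0_def poly_pcompose power2_eq_square)
    have "(\<integral>x. poly p x * poly g (poly (F (Suc s)) x) \<partial>\<mu>)
        = (\<integral>x. poly A x * poly (pCons 0 g1) (poly (F s) x) + poly B x * poly g1 (poly (F s) x) \<partial>\<mu>)"
      by (simp add: AB(1) g1 poly_F_Suc algebra_simps)
    also have "\<dots> = (\<integral>x. poly A x * poly (pCons 0 g1) (poly (F s) x) \<partial>\<mu>) + (\<integral>x. poly B x * poly g1 (poly (F s) x) \<partial>\<mu>)"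
      by (intro Bochner_Integration.integral_add integrable_poly_mult_comp)
    also have "(\<integral>x. poly A x * poly (pCons 0 g1) (poly (F s) x) \<partial>\<mu>)
        = CA * (\<integral>x. poly (F s) x * poly g0 ((poly (F s) x)\<^sup>2) \<partial>\<mu>)"
      by (subst CA) (simp add: g0 g1)
    also have "\<dots> = 0" by (simp add: integral_odd_F)
    finally show ?thesis using CB[of g1] by (simp add: g1 poly_F_Suc)
  qed
  then show ?case by blast
qed

text \<open>
  The case \<open>g = [:0, 1:]\<close> of the factorization, together with $\int F_s\,d\mu = 0$.
\<close>

lemma integral_F_mult_eq_0:
  assumes "degree q < 2 ^ s"
  shows "(\<integral>x. poly (F s) x * poly q x \<partial>\<mu>) = 0"
proof -
  obtain C where C: "\<And>g. (\<integral>x. poly q x * poly g (poly (F s) x) \<partial>\<mu>) = C * (\<integral>x. poly g (poly (F s) x) \<partial>\<mu>)"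
    using integral_low_degree_factor[OF assms] by blast
  have "(\<integral>x. poly (F s) x * poly q x \<partial>\<mu>) = C * (\<integral>x. poly (F s) x \<partial>\<mu>)"
    using C[of "[:0, 1:]"] by (simp add: mult.commute)
  also have "\<dots> = 0" using integral_odd_F[of s 1] by simp
  finally show ?thesis .
qed

lemma poly_eq_0_if_integral_square_eq_0:
  assumes "(\<integral>x. poly p x * poly p x \<partial>\<mu>) = 0"
  shows "p = 0"
proof (rule ccontr)
  assume "p \<noteq> 0"
  then have fin: "finite {x. poly p x = 0}" by (rule poly_roots_finite)
  have "AE x in \<mu>. poly p x * poly p x = 0"
    using assms by (subst (asm) integral_nonneg_eq_0_iff_AE[OF integrable_poly_mult]) auto
  moreover have "AE x in \<mu>. x \<notin> (\<Union>a\<in>{x. poly p x = 0}. {a})"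
    using fin no_atoms_if_finite_energy[OF dist_\<mu> finite_energy]
    by (intro AE_not_in null_sets_UN' countable_finite) (auto simp: null_sets_def)
  ultimately have "AE x in \<mu>. False" by eventually_elim auto
  then show False by simp
qed

lemma is_monic_orthogonal_iff: "is_monic_orthogonal_poly \<mu> (2 ^ s) Q \<longleftrightarrow> Q = F s"
proof
  assume Q: "is_monic_orthogonal_poly \<mu> (2 ^ s) Q"
  let ?p = "Q - F s"
  have deg: "degree ?p < 2 ^ s"
    using Q by (intro degree_monic_diff) (auto simp: is_monic_orthogonal_poly_def)
  have "(\<integral>x. poly ?p x * poly ?p x \<partial>\<mu>) = (\<integral>x. poly Q x * poly ?p x - poly (F s) x * poly ?p x \<partial>\<mu>)"
    by (simp add: algebra_simps)
  also have "\<dots> = (\<integral>x. poly Q x * poly ?p x \<partial>\<mu>) - (\<integral>x. poly (F s) x * poly ?p x \<partial>\<mu>)"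
    by (intro Bochner_Integration.integral_diff integrable_poly_mult)
  also have "\<dots> = 0"
    using Q deg integral_F_mult_eq_0[OF deg] by (simp only: is_monic_orthogonal_poly_def)
  finally show "Q = F s" using poly_eq_0_if_integral_square_eq_0[of ?p] by simp
next
  assume "Q = F s"
  then show "is_monic_orthogonal_poly \<mu> (2 ^ s) Q"
    using degree_F lead_coeff_F integral_F_mult_eq_0 by (auto simp: is_monic_orthogonal_poly_def)
qed

end

theorem theorem2p8:
  fixes \<gamma> :: "nat \<Rightarrow> real" and \<mu> :: "real measure" and s :: nat
  assumes gamma: "\<And>k. k \<ge> 1 \<Longrightarrow> 0 < \<gamma> k \<and> \<gamma> k < 1/4"
    and cap: "log_capacity (cantor_K \<gamma>) > 0"
    and eq: "is_equilibrium_measure (cantor_K \<gamma>) \<mu>"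
  shows "(\<forall>Q. is_monic_orthogonal_poly \<mu> (2 ^ s) Q \<longleftrightarrow> Q = P_pow2 \<gamma> s + [:r_seq \<gamma> s / 2:])
       \<and> (\<forall>T. is_chebyshev_poly (cantor_K \<gamma>) (2 ^ s) T \<longleftrightarrow> T = P_pow2 \<gamma> s + [:r_seq \<gamma> s / 2:])"
proof -
  interpret gamma_sequence \<gamma> by unfold_locales (rule gamma)
  interpret cantor_equilibrium \<gamma> \<mu>
  proof unfold_locales
    show "minimizes_energy (cantor_K \<gamma>) \<mu>"
      by (rule minimizes_energy_if_equilibrium[OF _ cap eq, of 0]) (use cantor_K_subset in simp)
  qed
  show ?thesis
    using is_monic_orthogonal_iff is_chebyshev_iff unfolding F_def by blast
qed

end
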